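(* Let $N$ be a positive integer. Then $${}_{12}W_{11}\left(k;\frac{qa}{k},\frac{k}{\sqrt a},\frac{-k}{\sqrt a},k\sqrt{\frac qa},-k\sqrt{\frac qa},\sqrt{ak}\,q^N,-\sqrt{ak}\,q^N,-q^{-N},q^{-N};q,q^2\right)$$ $$=\frac{\left(\frac ka,\,k^2q^2,\,-a,\,-aq;q^2\right)_N}{\left(\frac ak,\,a^2q^2,\,-kq,\,-kq^2;q^2\right)_N}\left(\frac{aq}{k}\right)^N\;{}_{7}\phi_{6}\left[\begin{matrix}iq\sqrt a,\,-iq\sqrt a,\,\frac{a^2q}{k^2},\,\sqrt{ak}\,q^N,\,-\sqrt{ak}\,q^N,\,-q^{-N},\,q^{-N}\\ i\sqrt a,\,-i\sqrt a,\,aq^{1+N},\,-aq^{1+N},\,\sqrt{\frac ak}\,q^{1-N},\,-\sqrt{\frac ak}\,q^{1-N}\end{matrix};q,q\right].$$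
   Context: For a base $t$ and $n\ge0$, $(x;t)_n=\prod_{i=0}^{n-1}(1-xt^i)$ and $(x_1,\dots,x_m;t)_n=\prod_{j=1}^m(x_j;t)_n$. The basic hypergeometric series is ${}_{r+1}\phi_r\left[\begin{matrix}a_1,\dots,a_{r+1}\\ b_1,\dots,b_r\end{matrix};q,x\right]=\sum_{n\ge0}\frac{(a_1,\dots,a_{r+1};q)_n}{(q,b_1,\dots,b_r;q)_n}x^n$; when $q^{-N}$ is an upper parameter the series terminates, and the sum is over $0\le n\le N$. Further, ${}_{r+1}W_r(a_1;a_4,\dots,a_{r+1};q,x)={}_{r+1}\phi_r\left[\begin{matrix}a_1,\,q\sqrt{a_1},\,-q\sqrt{a_1},\,a_4,\dots,a_{r+1}\\ \sqrt{a_1},\,-\sqrt{a_1},\,a_1q/a_4,\dots,a_1q/a_{r+1}\end{matrix};q,x\right]$. Here $i^2=-1$, and $q,a,k$ are nonzero complex numbers such that none of the denominators vanish; all square roots are fixed choices. *)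

theory Defs
  imports Complex_Main
begin

definition qpochhammer :: "complex \<Rightarrow> complex \<Rightarrow> nat \<Rightarrow> complex" where
  "qpochhammer x t n = (\<Prod>i<n. 1 - x * t ^ i)"

definition qpochhammers :: "complex list \<Rightarrow> complex \<Rightarrow> nat \<Rightarrow> complex" where
  "qpochhammers xs t n = (\<Prod>x\<leftarrow>xs. qpochhammer x t n)"

(* The upper list is meant to be one longer than the lower list, so that the general factor
   ((-1)^n q^(n choose 2))^(1+s-r) of the r-phi-s series is 1.
   If q^(-N) is an upper parameter, all numerators with n > N are 0, hence so are the terms
   (also where the denominator is 0, since 0 / 0 = 0), and the series is the sum over n \<le> N. *)
definition basic_hypergeom ::
  "complex list \<Rightarrow> complex list \<Rightarrow> complex \<Rightarrow> complex \<Rightarrow> complex" where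
  "basic_hypergeom as bs q x =
     (\<Sum>n. qpochhammers as q n / qpochhammers (q # bs) q n * x ^ n)"

(* Very-well-poised series: s is the chosen square root of the first parameter a, and cs are the
   parameters a_4, ..., a_(r+1). *)
definition very_well_poised_lower ::
  "complex \<Rightarrow> complex \<Rightarrow> complex list \<Rightarrow> complex \<Rightarrow> complex list" where
  "very_well_poised_lower s a cs q = s # - s # map (\<lambda>c. a * q / c) cs"

definition very_well_poised ::
  "complex \<Rightarrow> complex \<Rightarrow> complex list \<Rightarrow> complex \<Rightarrow> complex \<Rightarrow> complex" where
  "very_well_poised s a cs q x =
     basic_hypergeom (a # q * s # - (q * s) # cs) (very_well_poised_lower s a cs q) q x"

(* No denominator vanishes in the terms 0, ..., N of a series with lower parameters bs. *)
definition nonzero_denominators :: "complex list \<Rightarrow> complex \<Rightarrow> nat \<Rightarrow> bool" where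
  "nonzero_denominators bs q N \<longleftrightarrow> (\<forall>n\<le>N. qpochhammers (q # bs) q n \<noteq> 0)"

end

theory Submission
  imports Defs "HOL-Analysis.Continuum_Not_Denumerable" "HOL-Analysis.Elementary_Metric_Spaces"
    "HOL-Computational_Algebra.Formal_Power_Series" "HOL-Computational_Algebra.Polynomial"
begin

text \<open>
  Pairing the parameters \<open>\<plusminus>x\<close> turns both sides into sums against kernels
  \<open>(K/A; p)\<^bsub>N-n\<^esub> (K; p)\<^bsub>N+n\<^esub> / ((p; p)\<^bsub>N-n\<^esub> (Ap; p)\<^bsub>N+n\<^esub>)\<close> of a WP-Bailey chain
  with \<open>p = q\<^sup>2\<close> and \<open>K = ak\<close>, where \<open>A = k\<^sup>2\<close> on the left and \<open>A = a\<^sup>2\<close> on the right.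
  By the q-Saalschuetz sum the factor
  \<open>(k, qa/k, k\<^sup>2q\<^sup>n/a; q)\<^sub>n / ((q; q)\<^sub>n (aq; q)\<^bsub>2n\<^esub>)\<close> on the left is a WP-Bailey sum in base \<open>q\<close>
  of \<open>(a\<^sup>2q/k\<^sup>2; q)\<^sub>r (k/a)\<^sup>r / (q; q)\<^sub>r\<close>. After interchanging the summations, the sum over \<open>n\<close>
  is, up to a shift of the parameters, an 8W7 with free parameters \<open>k/a, \<plusminus>x, \<plusminus>y\<close>. As in Watson's
  transformation, the q-Saalschuetz sum and the 6phi5 sum reduce it to two sums that mix the bases
  \<open>q\<close> and \<open>p\<close>; these are coefficients of products of q-binomial series, which collapse because
  \<open>(z; q)\<^sub>\<infinity> = (z; p)\<^sub>\<infinity> (zq; p)\<^sub>\<infinity>\<close>. All this is done for parameters without monomial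
  relations; the general case follows by continuity.
\<close>

section \<open>Elementary identities for q-shifted factorials\<close>

lemma qpochhammer_0 [simp]: "qpochhammer x t 0 = 1"
  by (simp add: qpochhammer_def)

lemma qpochhammer_Suc [simp]: "qpochhammer x t (Suc n) = qpochhammer x t n * (1 - x * t ^ n)"
  by (simp add: qpochhammer_def)

lemma qpochhammer_eq_0_iff: "qpochhammer x t n = 0 \<longleftrightarrow> (\<exists>i<n. x * t ^ i = 1)"
  by (auto simp: qpochhammer_def)

lemma qpochhammer_add:
  "qpochhammer x t (m + n) = qpochhammer x t m * qpochhammer (x * t ^ m) t n"
  by (induction n) (simp_all add: power_add mult_ac)

lemma qpochhammer_shift: "(1 - x) * qpochhammer (x * t) t n = qpochhammer x t n * (1 - x * t ^ n)"
  using qpochhammer_add[of x t 1 n] by (simp add: mult.commute)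

lemma qpochhammer_square:
  "qpochhammer (x ^ 2) (t ^ 2) n = qpochhammer x t n * qpochhammer (- x) t n"
  by (induction n) (simp_all add: algebra_simps power2_eq_square power_mult_distrib)

lemma qpochhammer_double:
  "qpochhammer x t (2 * n) = qpochhammer x (t ^ 2) n * qpochhammer (x * t) (t ^ 2) n"
  by (induction n) (simp_all add: power_mult[of t 2] mult_ac, simp add: power_mult[of t 2, symmetric] mult_ac)

text \<open>\<open>(-1)\<^sup>n t\<^bsup>n(n-1)/2\<^esup>\<close>\<close>

definition qsign :: "complex \<Rightarrow> nat \<Rightarrow> complex" where
  "qsign t n = (\<Prod>i<n. - (t ^ i))"

lemma qsign_0 [simp]: "qsign t 0 = 1"
  by (simp add: qsign_def)

lemma qsign_Suc [simp]: "qsign t (Suc n) = - (t ^ n * qsign t n)"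
  by (simp add: qsign_def)

lemma qsign_nonzero [simp]: "t \<noteq> 0 \<Longrightarrow> qsign t n \<noteq> 0"
  by (simp add: qsign_def)

lemma qsign_add: "qsign t (m + n) = qsign t m * qsign t n * t ^ (m * n)"
  by (induction n) (simp_all add: power_add algebra_simps)

lemma qsign_square: "qsign (t ^ 2) n = (-1) ^ n * qsign t n ^ 2"
  by (induction n) (simp_all add: algebra_simps power2_eq_square power_mult_distrib)

text \<open>Each factor \<open>1 - c * t ^ i\<close> is \<open>- c * t ^ i\<close> times
  \<open>1 - 1 / (c * t ^ i)\<close>, and the latter are the factors of the product on the left,
  taken in reverse order.\<close>

lemma qpochhammer_reverse:
  assumes "t \<noteq> 0" "c \<noteq> 0"
  shows "qpochhammer (t / (c * t ^ n)) t n * (qsign t n * c ^ n) = qpochhammer c t n"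
proof (induction n)
  case (Suc n)
  have "qpochhammer (t / (c * t ^ Suc n)) t (Suc n) = (1 - t / (c * t ^ Suc n)) * qpochhammer (t / (c * t ^ n)) t n"
    using qpochhammer_add[of "t / (c * t ^ Suc n)" t 1 n] assms by simp
  then have "qpochhammer (t / (c * t ^ Suc n)) t (Suc n) * (qsign t (Suc n) * c ^ Suc n) =
      (1 - t / (c * t ^ Suc n)) * qpochhammer (t / (c * t ^ n)) t n * (- (t ^ n * qsign t n) * (c * c ^ n))"
    by (simp only: qsign_Suc power_Suc)
  also have "\<dots> = ((1 - t / (c * t ^ Suc n)) * (- (t ^ n) * c)) * (qpochhammer (t / (c * t ^ n)) t n * (qsign t n * c ^ n))"
    by (simp only: mult_ac mult_minus_left mult_minus_right)
  also have "(1 - t / (c * t ^ Suc n)) * (- (t ^ n) * c) = 1 - c * t ^ n"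
    using assms by (simp add: field_simps)
  finally show ?case using Suc by (simp add: mult.commute)
qed simp

text \<open>Moves the summation index out of a length \<open>n - r\<close>: the last
  \<open>r\<close> factors of the full product are split off and reversed. The base point is written
  through \<open>c\<close> because \<open>c\<close> becomes the parameter of the resulting factor of
  length \<open>r\<close>.\<close>

lemma qpochhammer_reverse_diff:
  assumes "t \<noteq> 0" "c \<noteq> 0" "r \<le> n" "qpochhammer c t r \<noteq> 0"
  shows "qpochhammer (t / (c * t ^ n)) t (n - r) =
    qpochhammer (t / (c * t ^ n)) t n * (qsign t r * c ^ r) / qpochhammer c t r"
proof -
  have "t / (c * t ^ n) * t ^ (n - r) = t / (c * t ^ r)"
    using assms by (simp add: field_simps flip: power_add)
  then have "qpochhammer (t / (c * t ^ n)) t n =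
      qpochhammer (t / (c * t ^ n)) t (n - r) * qpochhammer (t / (c * t ^ r)) t r"
    using qpochhammer_add[of "t / (c * t ^ n)" t "n - r" r] assms by simp
  then show ?thesis
    using qpochhammer_reverse[OF assms(1,2), of r] assms(4) by (simp add: field_simps)
qed

section \<open>Parameters that are not powers of the base\<close>

text \<open>For nonzero \<open>q\<close> this excludes all integral powers of \<open>q\<close>; a
  power on each side keeps the exponents natural numbers.\<close>

definition generic :: "complex \<Rightarrow> complex \<Rightarrow> bool" where
  "generic q x \<longleftrightarrow> (\<forall>m n. x * q ^ m \<noteq> q ^ n)"

lemma genericD: "generic q x \<Longrightarrow> x * q ^ m \<noteq> q ^ n"
  by (simp add: generic_def)

lemma generic_nonzero: "generic q x \<Longrightarrow> qpochhammer x q n \<noteq> 0"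
  using genericD[of q x _ 0] by (auto simp: qpochhammer_eq_0_iff)

lemma generic_nonzero2: "generic q x \<Longrightarrow> qpochhammer x (q ^ 2) n \<noteq> 0"
  using genericD[of q x _ 0] by (auto simp: qpochhammer_eq_0_iff simp flip: power_mult)

lemma generic_mult_power [simp]: "q \<noteq> 0 \<Longrightarrow> generic q (x * q ^ i) \<longleftrightarrow> generic q x"
proof -
  assume q: "q \<noteq> 0"
  have "x * q ^ m \<noteq> q ^ n" if "\<forall>m n. x * q ^ i * q ^ m \<noteq> q ^ n" for m n
    using that[rule_format, of m "n + i"] q by (auto simp: power_add)
  moreover have "x * q ^ i * q ^ m \<noteq> q ^ n" if "\<forall>m n. x * q ^ m \<noteq> q ^ n" for m n
    using that[rule_format, of "i + m" n] by (auto simp: power_add mult.assoc)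
  ultimately show ?thesis unfolding generic_def by blast
qed

lemma generic_divide_power [simp]: "q \<noteq> 0 \<Longrightarrow> generic q (x / q ^ i) \<longleftrightarrow> generic q x"
  using generic_mult_power[of q "x / q ^ i" i] by simp

lemma generic_mult [simp]: "q \<noteq> 0 \<Longrightarrow> generic q (x * q) \<longleftrightarrow> generic q x"
  using generic_mult_power[of q x 1] by simp

lemma generic_minus_mult [simp]: "q \<noteq> 0 \<Longrightarrow> generic q (- (x * q)) \<longleftrightarrow> generic q (- x)"
  using generic_mult[of q "- x"] by simp

lemma generic_inverse:
  assumes "x \<noteq> 0"
  shows "generic q (1 / x) \<longleftrightarrow> generic q x"
proof -
  have "1 / x * q ^ m = q ^ n \<longleftrightarrow> x * q ^ n = q ^ m" for m n
    using assms by (auto simp: divide_eq_eq mult.commute)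
  then show ?thesis unfolding generic_def by metis
qed

lemma generic_sqrt: "generic q (x ^ 2) \<Longrightarrow> generic q x \<and> generic q (- x)"
proof -
  assume *: "generic q (x ^ 2)"
  have "(x * q ^ m) ^ 2 \<noteq> (q ^ n) ^ 2" for m n
    using genericD[OF *, of "m * 2" "n * 2"] by (simp add: power_mult power_mult_distrib)
  then show ?thesis unfolding generic_def by (metis mult_minus_left power2_minus)
qed

lemma qsign_square_mult: "qsign t n ^ 2 * t ^ n = t ^ (n * n)"
  by (induction n) (simp_all add: power_mult_distrib power_add power2_eq_square mult_ac)

lemma sum_triangle_swap:
  "(\<Sum>m\<le>M. \<Sum>j\<le>m. f j m) = (\<Sum>j\<le>M. \<Sum>i\<le>M - j. f j (j + i))" for M :: nat
  unfolding sum.Sigma[OF finite_atMost ballI[OF finite_atMost]]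
  by (rule sum.reindex_bij_witness[of _ "\<lambda>(j, i). (j + i, j)" "\<lambda>(m, j). (j, m - j)"]) auto

section \<open>Both sides as finite sums without square roots\<close>

text \<open>The 12W11 with each pair of parameters \<open>x\<close>, \<open>- x\<close> merged into
  base \<open>q ^ 2\<close>. The upper factors combine to (k^2/a; q)_(2n), whose first half cancels
  against the lower parameter k^2/a that belongs to qa/k. Without square roots the sum is a rational
  function of \<open>q\<close>, \<open>a\<close>, \<open>k\<close>, as the continuity argument
  needs.\<close>

definition lhs_sum :: "nat \<Rightarrow> complex \<Rightarrow> complex \<Rightarrow> complex \<Rightarrow> complex" where
  "lhs_sum N q a k = (\<Sum>n\<le>N. (1 - k * q ^ (2 * n)) / (1 - k) *
     (qpochhammer k q n * qpochhammer (q * a / k) q n * qpochhammer (k ^ 2 * q ^ n / a) q n *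
      qpochhammer (a * k * q ^ (2 * N)) (q ^ 2) n * qpochhammer (1 / q ^ (2 * N)) (q ^ 2) n) /
     (qpochhammer q q n * qpochhammer (a * q) q (2 * n) *
      qpochhammer (k * q ^ 2 / (a * q ^ (2 * N))) (q ^ 2) n *
      qpochhammer (k ^ 2 * q ^ 2 * q ^ (2 * N)) (q ^ 2) n) * (q ^ 2) ^ n)"

text \<open>The 7phi6 after the same pairing; the quotient
  \<open>(1 + a * q ^ (2 * n)) / (1 + a)\<close> comes from the four parameters that contain the
  imaginary unit.\<close>

definition rhs_sum :: "nat \<Rightarrow> complex \<Rightarrow> complex \<Rightarrow> complex \<Rightarrow> complex" where
  "rhs_sum N q a k = (\<Sum>n\<le>N. (1 + a * q ^ (2 * n)) / (1 + a) *
     (qpochhammer (a ^ 2 * q / k ^ 2) q n *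
      qpochhammer (a * k * q ^ (2 * N)) (q ^ 2) n * qpochhammer (1 / q ^ (2 * N)) (q ^ 2) n) /
     (qpochhammer q q n * qpochhammer (a ^ 2 * q ^ 2 * q ^ (2 * N)) (q ^ 2) n *
      qpochhammer (a * q ^ 2 / (k * q ^ (2 * N))) (q ^ 2) n) * q ^ n)"

definition prefactor :: "nat \<Rightarrow> complex \<Rightarrow> complex \<Rightarrow> complex \<Rightarrow> complex" where
  "prefactor N q a k =
     qpochhammer (k / a) (q ^ 2) N * qpochhammer (k ^ 2 * q ^ 2) (q ^ 2) N * qpochhammer (- a) q (2 * N) /
     (qpochhammer (a / k) (q ^ 2) N * qpochhammer (a ^ 2 * q ^ 2) (q ^ 2) N * qpochhammer (- (k * q)) q (2 * N)) *
     (a * q / k) ^ N"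

locale generic_base =
  fixes q :: complex
  assumes q_nonzero [simp]: "q \<noteq> 0" and q_power: "n > 0 \<Longrightarrow> q ^ n \<noteq> 1"
begin

abbreviation P :: "complex \<Rightarrow> nat \<Rightarrow> complex" where "P x n \<equiv> qpochhammer x q n"
abbreviation P2 :: "complex \<Rightarrow> nat \<Rightarrow> complex" where "P2 x n \<equiv> qpochhammer x (q ^ 2) n"

lemma P_base_nonzero [simp]: "P q n \<noteq> 0"
  using q_power[of "Suc _"] by (auto simp: qpochhammer_eq_0_iff)

lemma P2_base_nonzero [simp]: "P2 (q ^ 2) n \<noteq> 0"
proof -
  have "q ^ 2 * (q ^ 2) ^ i \<noteq> 1" for i
    using q_power[of "2 * Suc i"] by (simp only: power_mult power_Suc) simp
  then show ?thesis by (auto simp: qpochhammer_eq_0_iff)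
qed

text \<open>Squaring \<open>q ^ m = - (q ^ n)\<close> gives equal even powers of \<open>q\<close>,
  hence \<open>m = n\<close>, which contradicts the sign.\<close>

lemma generic_minus_1: "generic q (-1)"
proof -
  have "q ^ m = - (q ^ n) \<Longrightarrow> False" for m n
  proof -
    assume *: "q ^ m = - (q ^ n)"
    then have "q ^ (2 * m) = q ^ (2 * n)"
      by (simp add: power_mult[of _ _ m] power_mult[of _ _ n] mult.commute[of 2] power_mult)
    then have "m = n"
    proof (induction m n rule: linorder_wlog)
      case (le m n)
      then have "q ^ (2 * m) * q ^ (2 * (n - m)) = q ^ (2 * m) * 1"
        by (metis add_mult_distrib2 le_add_diff_inverse mult_1_right power_add)
      then have "q ^ (2 * (n - m)) = 1" by simp
      then show ?case using q_power[of "2 * (n - m)"] le by fastforce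
    qed simp
    then show False using * q_nonzero by auto
  qed
  then show ?thesis unfolding generic_def by (metis minus_mult_minus mult_1 mult_minus1 minus_minus)
qed

section \<open>The q-Saalschuetz sum and the terminating 6phi5 sum\<close>

text \<open>The q-Saalschuetz sum as a convolution: it compares coefficients in Heine's
  transformation 2phi1(A, B; ABD; Dz) (Dz; q)_inf / (z; q)_inf = 2phi1(BD, AD; ABD; z). The proof
  avoids convergence: the sum satisfies a first-order recurrence in \<open>n\<close> that the right
  side visibly solves.\<close>

lemma convolution_saalschuetz:
  assumes "generic q (A * B * D)"
  shows "(\<Sum>r\<le>n. P A r * P B r / (P q r * P (A * B * D) r) * D ^ r * (P D (n - r) / P q (n - r))) =
    P (B * D) n * P (A * D) n / (P q n * P (A * B * D) n)"
proof -
  define C where "C = A * B * D"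
  define u where "u r = P A r * P B r / (P q r * P C r) * D ^ r" for r
  define v where "v i = P D i / P q i" for i
  define S where "S n = (\<Sum>r\<le>n. u r * v (n - r))" for n
  have nzC: "1 - C * q ^ n \<noteq> 0" for n
    using genericD[OF assms, of n 0] by (simp add: C_def)
  have nzq: "1 - q * q ^ n \<noteq> 0" for n
    using q_power[of "Suc n"] by simp
  have u_Suc: "u (Suc r) = u r * D * ((1 - A * q ^ r) * (1 - B * q ^ r)) / ((1 - q * q ^ r) * (1 - C * q ^ r))" for r
    by (simp add: u_def mult_ac)
  have v_Suc: "v (Suc r) = v r * (1 - D * q ^ r) / (1 - q * q ^ r)" for r
    by (simp add: v_def)
  have rec: "(1 - q ^ Suc n) * (1 - C * q ^ n) * S (Suc n) =
     (1 - B * D * q ^ n) * (1 - A * D * q ^ n) * S n" for n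
  proof -
    \<comment> \<open>the WZ mate of the summand, which turns the recurrence into a telescoping sum\<close>
    define g where "g r = - (q ^ (Suc n - r) * (1 - q ^ r) * (1 - C * q ^ r / q) * (u r * v (Suc n - r)))" for r
    have step: "(1 - q ^ Suc n) * (1 - C * q ^ n) * (u r * v (Suc n - r))
        - (1 - B * D * q ^ n) * (1 - A * D * q ^ n) * (u r * v (n - r)) = g (Suc r) - g r"
      if "r \<le> n" for r
    proof -
      define x w where "x = q ^ r" and "w = q ^ (n - r)"
      have xw: "q ^ n = x * w" using that by (simp add: x_def w_def flip: power_add)
      have nz: "1 - q * w \<noteq> 0" "1 - q * x \<noteq> 0" "1 - C * x \<noteq> 0"
        using nzq nzC by (simp_all add: x_def w_def)
      have gS: "g (Suc r) = - (w * (1 - A * x) * (1 - B * x) * D * (u r * v (n - r)))"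
        using nz by (simp add: g_def u_Suc flip: x_def w_def)
      have v': "v (Suc n - r) = v (n - r) * (1 - D * w) / (1 - q * w)"
        using that by (simp add: Suc_diff_le v_Suc flip: w_def)
      have gr: "g r = - (w * (1 - x) * (q - C * x) * (u r * (v (n - r) * (1 - D * w) / (1 - q * w))))"
      proof -
        have "q * (1 - C * x / q) = q - C * x" by (simp add: right_diff_distrib)
        moreover have "g r = - (w * (1 - x) * (q * (1 - C * x / q)) * (u r * v (Suc n - r)))"
          unfolding g_def using that by (simp add: Suc_diff_le flip: x_def w_def)
        ultimately show ?thesis unfolding v' by simp
      qed
      \<comment> \<open>Strips off the common factors \<open>U\<close>, \<open>V\<close> and the
        only denominator \<open>d = 1 - q * w\<close>, so that a polynomial identity in
        \<open>x\<close>, \<open>w\<close> and the parameters remains.\<close>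
      have clear1: "p1 * (U * (V * p3 / d)) - p2 * (U * V) = e1 * (U * V) - - (e2 * (U * (V * p3 / d)))"
        if "p1 * p3 - p2 * d = e1 * d + e2 * p3" "d \<noteq> 0" for p1 p2 p3 d e1 e2 U V :: complex
        using that by (simp add: divide_simps) algebra
      have "(1 - q * (x * w)) * (1 - C * (x * w)) * (1 - D * w)
         - (1 - B * D * (x * w)) * (1 - A * D * (x * w)) * (1 - q * w) =
         - (w * (1 - A * x) * (1 - B * x) * D) * (1 - q * w) + w * (1 - x) * (q - C * x) * (1 - D * w)"
        unfolding C_def by algebra
      from clear1[OF this nz(1), of "u r" "v (n - r)"] show ?thesis
        unfolding gS gr v' power_Suc xw by (simp only: mult.assoc minus_mult_left)
    qed
    \<comment> \<open>The term \<open>r = Suc n\<close> occurs only in \<open>S (Suc n)\<close>. It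
      cancels the upper end of the telescoping sum, and the lower end vanishes because
      \<open>g 0 = 0\<close>.\<close>
    have last: "(1 - q ^ Suc n) * (1 - C * q ^ n) * (u (Suc n) * v 0) = - g (Suc n)"
      by (simp add: g_def)
    have "(1 - q ^ Suc n) * (1 - C * q ^ n) * S (Suc n) - (1 - B * D * q ^ n) * (1 - A * D * q ^ n) * S n =
      (\<Sum>r\<le>n. (1 - q ^ Suc n) * (1 - C * q ^ n) * (u r * v (Suc n - r))
        - (1 - B * D * q ^ n) * (1 - A * D * q ^ n) * (u r * v (n - r)))
        + (1 - q ^ Suc n) * (1 - C * q ^ n) * (u (Suc n) * v 0)"
      unfolding S_def sum.atMost_Suc sum_subtractf sum_distrib_left[symmetric]
      by (simp only: diff_self_eq_0 distrib_left diff_add_eq)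
    also have "\<dots> = (\<Sum>r\<le>n. g (Suc r) - g r) - g (Suc n)"
      using step last by simp
    also have "\<dots> = 0"
      using sum_lessThan_telescope[of g "Suc n"] by (simp add: lessThan_Suc_atMost g_def)
    finally show ?thesis by simp
  qed
  have "S n = P (B * D) n * P (A * D) n / (P q n * P C n)"
  proof (induction n)
    case 0
    then show ?case by (simp add: S_def u_def v_def)
  next
    case (Suc n)
    have "S (Suc n) = (1 - B * D * q ^ n) * (1 - A * D * q ^ n) * S n / ((1 - q ^ Suc n) * (1 - C * q ^ n))"
      using rec[of n] nzq[of n] nzC[of n] by (simp add: eq_divide_eq mult_ac)
    then show ?case using Suc by (simp add: mult_ac)
  qed
  then show ?thesis by (simp add: S_def u_def v_def C_def)
qed

text \<open>The terminating 6phi5 sum with upper parameters \<open>b\<close>, \<open>c\<close> and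
  q^(-n). Writing \<open>a\<close> as \<open>b * c * d\<close> turns aq/b and aq/c into
  \<open>c * d * q\<close> and \<open>b * d * q\<close>, and the factor
  \<open>1 / (P q (n - i) * P (a * q) (n + i))\<close> carries q^(-n) and its partner. As before, a
  WZ mate yields a first-order recurrence in \<open>n\<close>.\<close>

lemma very_well_poised_6phi5:
  fixes b c d :: complex
  defines "a \<equiv> b * c * d"
  assumes a: "generic q a" and bd: "generic q (b * d)" and cd: "generic q (c * d)"
  shows "(\<Sum>i\<le>n. (1 - a * q ^ (2 * i)) * (P a i * P b i * P c i / (P q i * P (c * d * q) i * P (b * d * q) i)
      * qsign q i * (d * q) ^ i) / (P q (n - i) * P (a * q) (n + i))) =
    (1 - a) * P (d * q) n / (P q n * P (c * d * q) n * P (b * d * q) n)"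
proof -
  define u where "u i = P a i * P b i * P c i / (P q i * P (c * d * q) i * P (b * d * q) i) * qsign q i * (d * q) ^ i" for i
  define v where "v n i = 1 / (P q (n - i) * P (a * q) (n + i))" for n i
  define S where "S n = (\<Sum>i\<le>n. (1 - a * q ^ (2 * i)) * (u i * v n i))" for n
  have nz: "generic q x \<Longrightarrow> 1 - x * q * q ^ m \<noteq> 0" for x m
    using genericD[of q x "Suc m" 0] by (simp add: mult_ac)
  note nz' = nz[OF a] nz[OF bd] nz[OF cd]
  have nzq: "1 - q * q ^ n \<noteq> 0" for n
    using q_power[of "Suc n"] by simp
  have u_Suc: "u (Suc i) = - u i * (q ^ i * (d * q) * ((1 - a * q ^ i) * (1 - b * q ^ i) * (1 - c * q ^ i))) /
     ((1 - q * q ^ i) * (1 - c * d * q * q ^ i) * (1 - b * d * q * q ^ i))" for i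
    by (simp add: u_def mult_ac)
  have rec: "(1 - q ^ Suc n) * (1 - c * d * q ^ Suc n) * (1 - b * d * q ^ Suc n) * S (Suc n) =
     (1 - d * q ^ Suc n) * S n" for n
  proof -
    let ?l = "(1 - q ^ Suc n) * (1 - c * d * q ^ Suc n) * (1 - b * d * q ^ Suc n)"
    \<comment> \<open>the WZ mate of the summand\<close>
    define g where "g i = - (q ^ (Suc n - i) * (1 - q ^ i) * (1 - c * d * q ^ i) * (1 - b * d * q ^ i) *
        (u i / (P q (Suc n - i) * P (a * q) (n + i))))" for i
    have step: "?l * ((1 - a * q ^ (2 * i)) * (u i * v (Suc n) i))
        - (1 - d * q ^ Suc n) * ((1 - a * q ^ (2 * i)) * (u i * v n i)) = g (Suc i) - g i"
      if "i \<le> n" for i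
    proof -
      define x w where "x = q ^ i" and "w = q ^ (n - i)"
      define y where "y = q * (x * w)"
      have xw: "q ^ n = x * w" using that by (simp add: x_def w_def flip: power_add)
      have x2: "q ^ (2 * i) = x ^ 2" by (simp add: x_def power_mult mult.commute[of 2])
      have xn: "q ^ (n + i) = x * w * x" by (simp add: power_add xw x_def)
      have nz1: "1 - q * w \<noteq> 0" "1 - q * x \<noteq> 0" "1 - c * d * q * x \<noteq> 0" "1 - b * d * q * x \<noteq> 0"
        using nzq nz' by (simp_all add: x_def w_def)
      have nz2: "1 - a * y * x \<noteq> 0"
        using nz'(1)[of "n + i"] by (simp add: xn y_def mult_ac)
      have v': "v (Suc n) i = v n i / ((1 - q * w) * (1 - a * y * x))"
        using that by (simp add: v_def Suc_diff_le xn y_def mult_ac flip: w_def)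
      have gS: "g (Suc i) = y * d * (1 - a * x) * (1 - b * x) * (1 - c * x) * (u i * v n i) / (1 - a * y * x)"
      proof -
        have "g (Suc i) = - (w * (1 - q * x) * (1 - c * d * q * x) * (1 - b * d * q * x) * (u (Suc i) * (v n i / (1 - a * y * x))))"
          by (simp add: g_def v_def xn y_def mult_ac flip: x_def w_def)
        then show ?thesis unfolding u_Suc using nz1 by (simp add: y_def mult_ac flip: x_def)
      qed
      have gi: "g i = - (q * w * (1 - x) * (1 - c * d * x) * (1 - b * d * x) * (u i * v n i) / (1 - q * w))"
        unfolding g_def v_def using that by (simp add: Suc_diff_le flip: x_def w_def)
      \<comment> \<open>Clears the two denominators \<open>d1 = 1 - q * w\<close> and
        \<open>d2 = 1 - a * y * x\<close>, where \<open>y\<close> is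
        \<open>q ^ Suc n\<close>.\<close>
      have clear2: "p * (k * (U * (V / (d1 * d2)))) - r * (k * (U * V)) = e1 * (U * V) / d2 - - (e2 * (U * V) / d1)"
        if "k * (p - r * (d1 * d2)) = e1 * d1 + e2 * d2" "d1 \<noteq> 0" "d2 \<noteq> 0" for k p r d1 d2 e1 e2 U V :: complex
        using that by (simp add: divide_simps) algebra
      have "(1 - a * x ^ 2) * ((1 - y) * (1 - c * d * y) * (1 - b * d * y) - (1 - d * y) * ((1 - q * w) * (1 - a * y * x))) =
         y * d * (1 - a * x) * (1 - b * x) * (1 - c * x) * (1 - q * w)
         + q * w * (1 - x) * (1 - c * d * x) * (1 - b * d * x) * (1 - a * y * x)"
        unfolding a_def y_def by algebra
      from clear2[OF this nz1(1) nz2, of "u i" "v n i"] show ?thesis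
        unfolding gS gi v' power_Suc xw x2 y_def[symmetric]
        by (simp only: mult.assoc minus_mult_left)
    qed
    \<comment> \<open>In the top term the very-well-poised factor is exactly the last factor of
      \<open>P (a * q) (Suc n + Suc n)\<close>, so both cancel.\<close>
    have last: "?l * ((1 - a * q ^ (2 * Suc n)) * (u (Suc n) * v (Suc n) (Suc n))) = - g (Suc n)"
    proof -
      have "a * q * q ^ (n + Suc n) = a * q ^ (2 * Suc n)" by (simp add: power_add mult_2)
      then have "P (a * q) (Suc n + Suc n) = P (a * q) (n + Suc n) * (1 - a * q ^ (2 * Suc n))"
        by simp
      moreover have "1 - a * q ^ (2 * Suc n) \<noteq> 0" using genericD[OF a, of "2 * Suc n" 0] by simp
      ultimately show ?thesis by (simp add: g_def v_def del: qpochhammer_Suc)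
    qed
    have "?l * S (Suc n) - (1 - d * q ^ Suc n) * S n =
      (\<Sum>i\<le>n. ?l * ((1 - a * q ^ (2 * i)) * (u i * v (Suc n) i))
        - (1 - d * q ^ Suc n) * ((1 - a * q ^ (2 * i)) * (u i * v n i)))
        + ?l * ((1 - a * q ^ (2 * Suc n)) * (u (Suc n) * v (Suc n) (Suc n)))"
      unfolding S_def sum.atMost_Suc sum_subtractf sum_distrib_left[symmetric] by (simp only: distrib_left diff_add_eq)
    also have "\<dots> = (\<Sum>i\<le>n. g (Suc i) - g i) - g (Suc n)"
      using step last by simp
    also have "\<dots> = 0"
      using sum_lessThan_telescope[of g "Suc n"] by (simp add: lessThan_Suc_atMost g_def)
    finally show ?thesis by simp
  qed
  have "S n = (1 - a) * P (d * q) n / (P q n * P (c * d * q) n * P (b * d * q) n)"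
  proof (induction n)
    case 0
    then show ?case by (simp add: S_def u_def v_def)
  next
    case (Suc n)
    have "S (Suc n) = (1 - d * q ^ Suc n) * S n / ((1 - q ^ Suc n) * (1 - c * d * q ^ Suc n) * (1 - b * d * q ^ Suc n))"
      using rec[of n] nzq[of n] nz'[of n] by (simp add: eq_divide_eq mult_ac)
    then show ?case using Suc by (simp add: mult_ac)
  qed
  then show ?thesis by (simp add: S_def u_def v_def)
qed

section \<open>Coefficients of products of q-binomial series in the bases q and q^2\<close>

text \<open>With p = q^2, the q-binomial theorem gives F(z) = (z/q; q)_inf / (z/(bq); q)_inf and
  G(z) = (z/b; p)_inf / (z; p)_inf for the two factors. Splitting base q into base p leaves F(z)
  G(z) = (z/q; p)_inf / (z/(bq); p)_inf, again a q-binomial series. The second sum has F(qz) in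
  place of F(z).\<close>

lemma mixed_base_convolution:
  assumes "b \<noteq> 0"
  shows "(\<Sum>j\<le>M. P b j / P q j * (1 / (b * q)) ^ j * (P2 (1 / b) (M - j) / P2 (q ^ 2) (M - j))) =
      P2 b M / P2 (q ^ 2) M * (1 / (b * q)) ^ M" (is "?V = ?R")
    and "(\<Sum>j\<le>M. P b j / P q j * (1 / b) ^ j * (P2 (1 / b) (M - j) / P2 (q ^ 2) (M - j))) =
      P2 b M / P2 (q ^ 2) M * (q / b) ^ M" (is "?W = ?R'")
proof -
  \<comment> \<open>\<open>sc s\<close> substitutes \<open>s * z\<close> for the variable
    \<open>z\<close>, and \<open>l s\<close> is the factor \<open>1 - s * z\<close>. Infinite
    products are replaced by the difference equations that characterize them, which make sense for
    formal power series.\<close>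
  define sc where "sc s f = Abs_fps (\<lambda>n. s ^ n * fps_nth f n)" for s and f :: "complex fps"
  define l where "l s = 1 - fps_const s * fps_X" for s :: complex
  have sc_mult: "sc s (f * g) = sc s f * sc s g" for s f g
    by (rule fps_ext) (auto simp: sc_def fps_mult_nth sum_distrib_left mult_ac simp flip: power_add
        intro!: sum.cong)
  have sc_sc: "sc s (sc t f) = sc (s * t) f" for s t f
    by (rule fps_ext) (simp add: sc_def power_mult_distrib)
  have sc_l: "sc s (l t) = l (s * t)" for s t
    by (rule fps_ext) (simp add: sc_def l_def fps_X_def)
  have l_nz: "l s \<noteq> 0" for s
    by (auto simp: fps_eq_iff l_def intro!: exI[of _ 0])
  \<comment> \<open>A first-order recurrence for the coefficients amounts to the equation f(tz) (1 -
    rz) = f(z) (1 - sz); \<open>step'\<close> is the converse.\<close>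
  have step: "sc t f * l r = f * l s"
    if "\<And>n. fps_nth f (Suc n) * (1 - t ^ Suc n) = fps_nth f n * (s - t ^ n * r)" for f t r s
  proof (rule fps_ext)
    fix n show "fps_nth (sc t f * l r) n = fps_nth (f * l s) n"
      using that[of "n - 1"] by (cases n) (simp_all add: sc_def l_def algebra_simps)
  qed
  have step': "fps_nth f (Suc n) * (1 - t ^ Suc n) = fps_nth f n * (s - t ^ n * r)"
    if "sc t f * l r = f * l s" for f t r s n
    using arg_cong[OF that, of "\<lambda>h. fps_nth h (Suc n)"] by (simp add: sc_def l_def algebra_simps)
  define F where "F = Abs_fps (\<lambda>j. P b j / P q j * (1 / (b * q)) ^ j)"
  define G where "G = Abs_fps (\<lambda>i. P2 (1 / b) i / P2 (q ^ 2) i)"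
  have nz: "1 - q * q ^ n \<noteq> 0" "1 - q ^ 2 * (q ^ 2) ^ n \<noteq> 0" for n
    using q_power[of "Suc n"] q_power[of "2 * Suc n"] by (simp_all only: power_mult power_Suc) simp_all
  have F: "sc q F * l (1 / q) = F * l (1 / (b * q))"
    using assms nz by (intro step) (simp add: F_def field_simps)
  have F2: "sc (q ^ 2) F * l 1 = sc q F * l (1 / b)"
    using arg_cong[OF F, of "sc q"] by (simp add: sc_mult sc_sc sc_l power2_eq_square)
  have G: "sc (q ^ 2) G * l (1 / b) = G * l 1"
    using assms nz by (intro step) (simp add: G_def)
  have "sc (q ^ 2) (F * G) * l (1 / q) * (l 1 * l (1 / b)) =
      (sc (q ^ 2) F * l 1) * l (1 / q) * (sc (q ^ 2) G * l (1 / b))"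
    by (simp add: sc_mult mult_ac)
  also have "\<dots> = (sc q F * l (1 / q)) * G * (l 1 * l (1 / b))"
    unfolding F2 G by (simp only: mult_ac)
  finally have 1: "sc (q ^ 2) (F * G) * l (1 / q) = sc q F * G * l (1 / q)"
    by (simp add: l_nz mult_ac)
  \<comment> \<open>Formal power series over a field have no zero divisors, so the linear factors
    cancel. Hence the second sum, a coefficient of F(qz) G(z), is \<open>q ^ (2 * M)\<close> times
    the first one.\<close>
  then have W: "sc (q ^ 2) (F * G) = sc q F * G"
    by (simp add: l_nz)
  \<comment> \<open>The difference equation in base \<open>q ^ 2\<close> for the product, which
    determines all its coefficients from the constant one.\<close>
  have H: "sc (q ^ 2) (F * G) * l (1 / q) = (F * G) * l (1 / (b * q))"
    unfolding W using F by (metis mult.assoc mult.commute)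
  have V: "fps_nth (F * G) M = P2 b M / P2 (q ^ 2) M * (1 / (b * q)) ^ M" for M
  proof (induction M)
    case (Suc M)
    have "fps_nth (F * G) (Suc M) * (1 - q ^ 2 * (q ^ 2) ^ M) = fps_nth (F * G) M * (1 / (b * q) - (q ^ 2) ^ M * (1 / q))"
      using step'[OF H, of M] by simp
    also have "\<dots> = fps_nth (F * G) M * (1 / (b * q)) * (1 - b * (q ^ 2) ^ M)"
      using assms by (simp add: field_simps)
    finally have "fps_nth (F * G) (Suc M) = fps_nth (F * G) M * (1 / (b * q)) * (1 - b * (q ^ 2) ^ M) / (1 - q ^ 2 * (q ^ 2) ^ M)"
      using nz(2)[of M] assms by (simp add: eq_divide_eq mult_ac)
    then show ?case unfolding Suc by (simp add: mult_ac)
  qed (simp add: F_def G_def)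
  have "?V = fps_nth (F * G) M"
    by (simp add: fps_mult_nth F_def G_def atLeast0AtMost)
  then show "?V = ?R" using V by simp
  have "?W = fps_nth (sc q F * G) M"
    by (simp add: fps_mult_nth F_def G_def sc_def atLeast0AtMost power_divide power_mult_distrib cong: sum.cong)
  also have "\<dots> = q ^ (2 * M) * ?R"
    unfolding W[symmetric] using V by (simp add: sc_def power_mult)
  also have "\<dots> = ?R'"
    unfolding mult_2 power_add using assms by (simp add: field_simps)
  finally show "?W = ?R'" .
qed

section \<open>Two specializations of the q-Saalschuetz sum\<close>

text \<open>Up to a constant, the left side is the balanced series 3phi2(q^(-m), Kq^m, B; c, -c; q,
  q) with c = Kq/sqrt(X), whose lower parameters merge into base \<open>q ^ 2\<close>. Read from
  right to left, it expands a quotient of base \<open>q ^ 2\<close> products in base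
  \<open>q\<close>.\<close>

lemma saalschuetz_square:
  fixes K X :: complex
  assumes K: "K \<noteq> 0" and X: "X \<noteq> 0" and gen: "generic q (K ^ 2 / X)"
  defines "B \<equiv> - (K * q / X)"
  shows "(\<Sum>r\<le>m. P (K * q ^ m) r * P B r * qsign q r * q ^ r /
      (q ^ (m * r) * P q r * P q (m - r) * P2 (K ^ 2 * q ^ 2 / X) r)) =
    B ^ m * P2 X m / (P q m * P2 (K ^ 2 * q ^ 2 / X) m)"
proof -
  obtain x where x: "x ^ 2 = X" by (metis power2_csqrt)
  with X have x0: "x \<noteq> 0" by auto
  define c c' where "c = K * q / x" and "c' = - c"
  \<comment> \<open>This choice makes \<open>c\<close> the lower parameter
    \<open>K * q ^ m * B * D\<close> of the convolution, while reversing \<open>P D (m - r)\<close>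
    puts the other lower parameter \<open>c'\<close> into the denominator. The reversal also
    produces the constant \<open>P D m\<close>, which is cancelled at the end.\<close>
  define D where "D = q / (c' * q ^ m)"
  have nz: "K \<noteq> 0" "x \<noteq> 0" "c \<noteq> 0" "c' \<noteq> 0" "D \<noteq> 0" using K x0 by (auto simp: c_def c'_def D_def)
  have gK: "generic q (K / x)" "generic q (- (K / x))"
    using generic_sqrt[of q "K / x"] gen by (simp_all add: power_divide x)
  moreover have c_eq: "c = K / x * q" "c' = - (K / x) * q" by (simp_all add: c_def c'_def)
  ultimately have gc: "generic q c" "generic q c'"
    unfolding c_eq by (simp_all only: generic_mult[OF q_nonzero])
  have cc: "P c r * P c' r = P2 (K ^ 2 * q ^ 2 / X) r" for r
    unfolding c'_def qpochhammer_square[symmetric] by (simp add: c_def power_divide power_mult_distrib x)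
  have ABD: "K * q ^ m * B * D = c"
    unfolding B_def D_def c'_def c_def x[symmetric] using nz by (simp add: field_simps power2_eq_square)
  have BD: "B * D = q / (x * q ^ m)" and AD: "K * q ^ m * D = - x"
    unfolding B_def D_def c'_def c_def x[symmetric] using nz by (simp_all add: field_simps power2_eq_square)
  have Dm: "P D m * (qsign q m * c' ^ m) = P c' m"
    unfolding D_def using nz by (intro qpochhammer_reverse) auto
  have Dnz: "P D m \<noteq> 0" using Dm generic_nonzero[OF gc(2), of m] by auto
  have xm: "P (q / (x * q ^ m)) m * (qsign q m * x ^ m) = P x m"
    using nz by (intro qpochhammer_reverse) auto
  have "P D m * (\<Sum>r\<le>m. P (K * q ^ m) r * P B r * qsign q r * q ^ r /
      (q ^ (m * r) * P q r * P q (m - r) * P2 (K ^ 2 * q ^ 2 / X) r)) =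
     (\<Sum>r\<le>m. P (K * q ^ m) r * P B r / (P q r * P (K * q ^ m * B * D) r) * D ^ r * (P D (m - r) / P q (m - r)))"
    unfolding sum_distrib_left
  proof (intro sum.cong refl)
    fix r assume "r \<in> {..m}"
    then have r: "r \<le> m" by simp
    have "P D (m - r) = P D m * (qsign q r * c' ^ r) / P c' r"
      unfolding D_def using nz r generic_nonzero[OF gc(2)] by (intro qpochhammer_reverse_diff) auto
    moreover have "D ^ r * c' ^ r = q ^ r / q ^ (m * r)"
      unfolding D_def power_mult power_mult_distrib[symmetric] power_divide[symmetric] using nz by simp
    ultimately have "D ^ r * P D (m - r) = P D m * qsign q r * (q ^ r / q ^ (m * r)) / P c' r"
      by (metis (no_types, lifting) mult.assoc mult.commute times_divide_eq_right)
    then have "P (K * q ^ m) r * P B r / (P q r * P c r) * (D ^ r * P D (m - r)) / P q (m - r) =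
       P (K * q ^ m) r * P B r / (P q r * P c r) * (P D m * qsign q r * (q ^ r / q ^ (m * r)) / P c' r) / P q (m - r)"
      by (simp only:)
    then show "P D m * (P (K * q ^ m) r * P B r * qsign q r * q ^ r /
      (q ^ (m * r) * P q r * P q (m - r) * P2 (K ^ 2 * q ^ 2 / X) r)) =
      P (K * q ^ m) r * P B r / (P q r * P (K * q ^ m * B * D) r) * D ^ r * (P D (m - r) / P q (m - r))"
      unfolding ABD cc[symmetric] by (simp add: mult_ac)
  qed
  also have "\<dots> = P (q / (x * q ^ m)) m * P (- x) m / (P q m * P c m)"
    unfolding convolution_saalschuetz[of "K * q ^ m" B D, unfolded ABD, OF gc(1)] ABD BD AD ..
  also have "\<dots> = P D m * (B ^ m * P2 X m / (P q m * P2 (K ^ 2 * q ^ 2 / X) m))"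
  proof -
    have "B * x = c'"
      unfolding B_def c'_def c_def x[symmetric] using nz by (simp add: power2_eq_square)
    then have "B ^ m * x ^ m = c' ^ m" by (simp flip: power_mult_distrib)
    then have "P c' m * P (q / (x * q ^ m)) m = B ^ m * (P D m * P x m)"
      unfolding Dm[symmetric] xm[symmetric] by (simp add: mult_ac)
    moreover have "P2 X m = P x m * P (- x) m" unfolding x[symmetric] qpochhammer_square ..
    ultimately show ?thesis unfolding cc[symmetric] using generic_nonzero[OF gc(2), of m]
      by (simp add: divide_simps) (simp add: mult_ac)
  qed
  finally show ?thesis using Dnz by (simp only: mult_cancel_left) simp
qed

text \<open>Once \<open>P k n / P (a * q) n\<close> is taken out, this is the convolution with
  \<open>A = k * q ^ n\<close> and \<open>D = k / a\<close>. The right side is the base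
  \<open>q\<close> part of the summand of \<open>lhs_sum\<close>.\<close>

lemma saalschuetz_bailey_pair:
  assumes "a \<noteq> 0" "k \<noteq> 0" "generic q a"
  shows "(\<Sum>r\<le>n. P (k / a) (n - r) * P k (n + r) / (P q (n - r) * P (a * q) (n + r)) * (k / a) ^ r *
      (P (a ^ 2 * q / k ^ 2) r / P q r)) =
    P k n * P (a * q / k) n * P (k ^ 2 * q ^ n / a) n / (P q n * P (a * q) (2 * n))"
proof -
  define B where "B = a ^ 2 * q / k ^ 2"
  have ABD: "k * q ^ n * B * (k / a) = a * q * q ^ n"
    and BD: "B * (k / a) = a * q / k" and AD: "k * q ^ n * (k / a) = k ^ 2 * q ^ n / a"
    using assms by (simp_all add: B_def field_simps power2_eq_square)
  have gen: "generic q (a * q * q ^ n)" using assms by simp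
  have "(\<Sum>r\<le>n. P (k / a) (n - r) * P k (n + r) / (P q (n - r) * P (a * q) (n + r)) * (k / a) ^ r *
      (P B r / P q r)) = P k n / P (a * q) n *
      (\<Sum>r\<le>n. P (k * q ^ n) r * P B r / (P q r * P (a * q * q ^ n) r) * (k / a) ^ r * (P (k / a) (n - r) / P q (n - r)))"
    unfolding sum_distrib_left by (intro sum.cong refl) (simp add: qpochhammer_add mult_ac)
  also have "\<dots> = P k n / P (a * q) n * (P (a * q / k) n * P (k ^ 2 * q ^ n / a) n / (P q n * P (a * q * q ^ n) n))"
    using convolution_saalschuetz[of "k * q ^ n" B "k / a" n] gen unfolding ABD BD AD by simp
  finally show ?thesis unfolding B_def mult_2 qpochhammer_add by (simp add: mult_ac)
qed

section \<open>Evaluating the inner sum as in Watson's transformation\<close>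

text \<open>The inner sum that \<open>base_change_sum\<close> meets after its interchange, with
  \<open>m = j + i\<close>. It is a terminating 6phi5 whose leading parameter is shifted to
  \<open>K * q ^ (2 * j)\<close>.\<close>

lemma shifted_6phi5_sum:
  assumes j: "j \<le> M" and A: "A \<noteq> 0" "generic q A" and K: "K \<noteq> 0" "generic q K" "generic q (- K)"
  shows "(\<Sum>i\<le>M - j. (1 - K * q ^ (2 * (j + i))) * P (K / A) (j + i) * P K (j + i + j) / (P (A * q) (j + i) * P q i) *
       (qsign (q ^ 2) (j + i) * (- (A * q)) ^ (j + i) / q ^ ((j + i) * j)) /
       (P q (M - (j + i)) * P (- q) (M - (j + i)) * P (K * q) (M + (j + i)) * P (- (K * q)) (M + (j + i)))) =
     (1 - K) * A ^ j * P (K / A) j * P (- (A * q * q ^ M)) (M - j) /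
       (P2 (q ^ 2) (M - j) * P (A * q) M * P (- (K * q)) (2 * M))"
proof -
  define n where "n = M - j"
  define b where "b = K / A"
  \<comment> \<open>Equal to -q^(-n): reversing \<open>P (- q) (n - i)\<close> produces a factor
    with this parameter. Then \<open>d\<close> is forced by the product
    \<open>K * q ^ (2 * j)\<close> of the three parameters.\<close>
  define c where "c = - (q ^ j / q ^ M)"
  define d where "d = - (A * q ^ M)"
  have nz: "b \<noteq> 0" "c \<noteq> 0" "d \<noteq> 0" using A K by (auto simp: b_def c_def d_def)
  have M: "M = j + n" using j by (simp add: n_def)
  have bcd: "b * q ^ j * c * d = K * q ^ (2 * j)" and bd: "b * q ^ j * d = - (K * q ^ (M + j))"
    and cd: "c * d = A * q ^ j" and cn: "q / (c * q ^ n) = - q"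
    unfolding mult_2 power_add M using A K by (simp_all add: b_def c_def d_def M field_simps power_add)
  have gc: "generic q c"
    using generic_minus_1 generic_divide_power[of q "- (q ^ j)" M] generic_mult_power[of q "- 1" j] by (simp add: c_def)
  have g: "generic q (b * q ^ j * c * d)" "generic q (b * q ^ j * d)" "generic q (c * d)"
    unfolding bcd bd cd using A K generic_mult_power[of q "- K" "M + j"] by simp_all
  define cf where "cf = P b j * P K (2 * j) * (qsign (q ^ 2) j * (- (A * q)) ^ j / q ^ (j * j)) /
      (P (A * q) j * P (- q) n * P (- (K * q)) (M + j) * P (K * q) (2 * j))"
  note nzP = generic_nonzero[OF gc] generic_nonzero[of q "A * q"] generic_nonzero[of q "K * q"]
    generic_nonzero[of q "- K * q"] generic_nonzero[of q "-1 * q"]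
  have nzq: "P (- q) m \<noteq> 0" "P (A * q) m \<noteq> 0" "P (K * q) m \<noteq> 0" "P (- (K * q)) m \<noteq> 0" for m
    using nzP(2-5)[of m] A K generic_minus_1 generic_minus_mult[of q 1] by simp_all
  have "(\<Sum>i\<le>n. (1 - K * q ^ (2 * (j + i))) * P b (j + i) * P K (j + i + j) / (P (A * q) (j + i) * P q i) *
       (qsign (q ^ 2) (j + i) * (- (A * q)) ^ (j + i) / q ^ ((j + i) * j)) /
       (P q (n - i) * P (- q) (n - i) * P (K * q) (M + (j + i)) * P (- (K * q)) (M + (j + i)))) =
     cf * (\<Sum>i\<le>n. (1 - K * q ^ (2 * j) * q ^ (2 * i)) * (P (K * q ^ (2 * j)) i * P (b * q ^ j) i * P c i /
        (P q i * P (c * d * q) i * P (b * q ^ j * d * q) i)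
      * qsign q i * (d * q) ^ i) / (P q (n - i) * P (K * q ^ (2 * j) * q) (n + i)))"
    unfolding sum_distrib_left
  proof (intro sum.cong refl)
    fix i assume "i \<in> {..n}"
    then have i: "i \<le> n" by simp
    \<comment> \<open>Each factor is split into a part without \<open>i\<close>, collected in
      \<open>cf\<close>, and the matching factor of the 6phi5.\<close>
    have f1: "P b (j + i) = P b j * P (b * q ^ j) i" by (rule qpochhammer_add)
    have f2: "P K (j + i + j) = P K (2 * j) * P (K * q ^ (2 * j)) i"
      using qpochhammer_add[of K q "j + j" i] unfolding mult_2 by (simp add: ac_simps)
    have f3: "P (A * q) (j + i) = P (A * q) j * P (c * d * q) i"
      unfolding cd qpochhammer_add by (simp add: mult_ac)
    have f4: "P (- q) (n - i) = P (- q) n * (qsign q i * c ^ i) / P c i"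
      using qpochhammer_reverse_diff[of q c i n] nz i nzP(1) unfolding cn by simp
    have f5: "P (K * q) (M + (j + i)) = P (K * q) (2 * j) * P (K * q ^ (2 * j) * q) (n + i)"
      using qpochhammer_add[of "K * q" q "j + j" "n + i"] unfolding mult_2 M by (simp add: ac_simps)
    have f6: "P (- (K * q)) (M + (j + i)) = P (- (K * q)) (M + j) * P (b * q ^ j * d * q) i"
      using qpochhammer_add[of "- (K * q)" q "M + j" i] unfolding bd by (simp add: ac_simps)
    \<comment> \<open>One \<open>qsign q i\<close> and the power of \<open>d * q\<close> belong to
      the 6phi5; the last bracket cancels what the reversal in \<open>f4\<close> leaves in the
      denominator.\<close>
    have f7: "qsign (q ^ 2) (j + i) * (- (A * q)) ^ (j + i) / q ^ ((j + i) * j) =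
       (qsign (q ^ 2) j * (- (A * q)) ^ j / q ^ (j * j)) * (qsign q i * (d * q) ^ i) * (qsign q i * c ^ i)"
    proof -
      have "d * q * c = A * q * q ^ j"
        using cd by (simp add: mult_ac)
      then have "(d * q) ^ i * c ^ i = A ^ i * q ^ i * q ^ (j * i)"
        unfolding power_mult power_mult_distrib[symmetric] by (simp only:)
      moreover have "(q ^ 2) ^ (j * i) = q ^ (j * i) * q ^ (j * i)"
        by (simp add: power2_eq_square power_mult_distrib)
      moreover have "(- (A * q)) ^ (j + i) = (- (A * q)) ^ j * ((- 1) ^ i * (A ^ i * q ^ i))"
        unfolding power_add power_minus[of "A * q" i] power_mult_distrib ..
      moreover have "q ^ ((j + i) * j) = q ^ (j * j) * q ^ (j * i)"
        by (simp only: power_add distrib_right mult.commute[of j i])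
      moreover have "(- 1) ^ i * (- 1) ^ i = (1 :: complex)"
        by (simp flip: power_mult_distrib)
      ultimately have "(d * q) ^ i * c ^ i = A ^ i * q ^ i * q ^ (j * i)"
        "qsign (q ^ 2) (j + i) * (- (A * q)) ^ (j + i) / q ^ ((j + i) * j) =
        (qsign (q ^ 2) j * (- (A * q)) ^ j / q ^ (j * j)) * (qsign q i) ^ 2 * (A ^ i * q ^ i * q ^ (j * i))"
        unfolding qsign_add qsign_square[of q i] by (simp_all add: mult_ac)
      then show ?thesis by (simp add: power2_eq_square mult_ac)
    qed
    have f8: "K * q ^ (2 * (j + i)) = K * q ^ (2 * j) * q ^ (2 * i)" by (simp add: power_add distrib_left)
    have nzs: "qsign q i * c ^ i \<noteq> 0" using nz by simp
    show "(1 - K * q ^ (2 * (j + i))) * P b (j + i) * P K (j + i + j) / (P (A * q) (j + i) * P q i) *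
       (qsign (q ^ 2) (j + i) * (- (A * q)) ^ (j + i) / q ^ ((j + i) * j)) /
       (P q (n - i) * P (- q) (n - i) * P (K * q) (M + (j + i)) * P (- (K * q)) (M + (j + i))) =
       cf * ((1 - K * q ^ (2 * j) * q ^ (2 * i)) * (P (K * q ^ (2 * j)) i * P (b * q ^ j) i * P c i /
        (P q i * P (c * d * q) i * P (b * q ^ j * d * q) i)
      * qsign q i * (d * q) ^ i) / (P q (n - i) * P (K * q ^ (2 * j) * q) (n + i)))"
      unfolding f1 f2 f3 f4 f5 f6 f7 f8 cf_def using nzs nz(2) nzP(1)[of i] by (simp add: mult_ac)
  qed
  also have "\<dots> = cf * ((1 - K * q ^ (2 * j)) * P (d * q) n / (P q n * P (c * d * q) n * P (b * q ^ j * d * q) n))"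
    using very_well_poised_6phi5[OF g, of n] unfolding bcd by simp
  also have "\<dots> = (1 - K) * A ^ j * P b j * P (- (A * q * q ^ M)) n /
       (P2 (q ^ 2) n * P (A * q) M * P (- (K * q)) (2 * M))"
  proof -
    have h1: "P (K * q) (2 * j) * (1 - K) = P K (2 * j) * (1 - K * q ^ (2 * j))"
      using qpochhammer_shift[of K q "2 * j"] by (simp add: mult.commute)
    have h2: "P (A * q) M = P (A * q) j * P (c * d * q) n"
      unfolding M cd qpochhammer_add by (simp add: mult_ac)
    have h3: "P (- (K * q)) (2 * M) = P (- (K * q)) (M + j) * P (b * q ^ j * d * q) n"
      using qpochhammer_add[of "- (K * q)" q "M + j" n] unfolding bd mult_2 M by (simp add: ac_simps)
    have h4: "P2 (q ^ 2) n = P q n * P (- q) n" by (rule qpochhammer_square)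
    have h5: "qsign (q ^ 2) j * (- (A * q)) ^ j / q ^ (j * j) = A ^ j"
    proof -
      have "qsign (q ^ 2) j * (- (A * q)) ^ j = A ^ j * (qsign q j ^ 2 * q ^ j)"
        unfolding qsign_square by (simp add: power_minus[of "A * q"] power_mult_distrib)
      then show ?thesis unfolding qsign_square_mult by simp
    qed
    have h6: "d * q = - (A * q * q ^ M)" by (simp add: d_def)
    have "cf = P b j * P K (2 * j) * A ^ j /
      (P (A * q) j * P (- q) n * P (- (K * q)) (M + j) * P (K * q) (2 * j))"
      unfolding cf_def h5 ..
    then have "cf * ((1 - K * q ^ (2 * j)) * P (d * q) n / (P q n * P (c * d * q) n * P (b * q ^ j * d * q) n)) =
       P b j * (P K (2 * j) * (1 - K * q ^ (2 * j))) * A ^ j * P (d * q) n /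
      ((P q n * P (- q) n) * (P (A * q) j * P (c * d * q) n) * (P (- (K * q)) (M + j) * P (b * q ^ j * d * q) n) * P (K * q) (2 * j))"
      by (simp add: mult_ac)
    also have "\<dots> = (1 - K) * A ^ j * P b j * P (- (A * q * q ^ M)) n /
       (P2 (q ^ 2) n * P (A * q) M * P (- (K * q)) (2 * M))"
      unfolding h1[symmetric] h2[symmetric] h3[symmetric] h4[symmetric] h6 using nzq by (simp add: mult_ac)
    finally show ?thesis .
  qed
  finally show ?thesis unfolding b_def n_def by simp
qed

text \<open>The outer sum left by the 6phi5. After reversal, \<open>P B j\<close> meets
  \<open>P c j\<close> with \<open>B = c * q\<close>, and their quotient is
  \<open>(1 - c * q ^ j) / (1 - c)\<close>. The sum is therefore a combination of the two sums of
  \<open>mixed_base_convolution\<close> with weights 1 and \<open>- c\<close>.\<close>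

lemma mixed_base_sum:
  fixes A K :: complex and M :: nat
  assumes A: "A \<noteq> 0" "generic q (- A)" and K: "K \<noteq> 0" "generic q (K / A)"
  defines "B \<equiv> - (q / (A * q ^ (2 * M)))"
  shows "(\<Sum>j\<le>M. P B j * qsign q j * q ^ j / (P q j * P2 (K / A * q ^ 2 / q ^ (2 * M)) j) *
       (A ^ j * P (K / A) j * P (- (A * q * q ^ M)) (M - j) / P2 (q ^ 2) (M - j))) =
     P (- (A * q * q ^ M)) M / P2 (A / K) M * (P2 (K / A) M / P2 (q ^ 2) M) * (A * q / K) ^ M *
     ((1 + A) / (1 + A * q ^ (2 * M)))"
proof -
  define b where "b = K / A"
  define c where "c = B / q"
  define c2 where "c2 = b * q ^ 2 / q ^ (2 * M)"
  have nz: "b \<noteq> 0" "c \<noteq> 0" "c2 \<noteq> 0" using A K by (auto simp: b_def c_def B_def c2_def)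
  have cM: "q / (c * q ^ M) = - (A * q * q ^ M)"
    using A by (simp add: c_def B_def power_add mult_2)
  have c2M: "q ^ 2 / (c2 * (q ^ 2) ^ M) = 1 / b"
    using nz by (simp add: c2_def power_mult)
  have gc: "generic q c"
  proof -
    have "c = 1 / (- A) / q ^ (2 * M)" by (simp add: c_def B_def)
    moreover have "generic q (1 / (- A))" using A generic_inverse[of "- A" q] by simp
    ultimately show ?thesis by (simp only: generic_divide_power[OF q_nonzero])
  qed
  have gb: "generic q b" "generic q (1 / b)" using K A generic_inverse[of "K / A" q] by (simp_all add: b_def)
  have gc2: "generic q c2" using gb by (simp add: c2_def)
  have c1: "1 - c \<noteq> 0" using genericD[OF gc, of 0 0] by simp
  define PM where "PM = P (- (A * q * q ^ M)) M"
  define cf where "cf = PM / ((1 - c) * P2 (1 / b) M)"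
  have "P B j * qsign q j * q ^ j / (P q j * P2 c2 j) * (A ^ j * P b j * P (- (A * q * q ^ M)) (M - j) / P2 (q ^ 2) (M - j)) =
    cf * (P b j / P q j * (1 / (b * q)) ^ j * (P2 (1 / b) (M - j) / P2 (q ^ 2) (M - j))
       - c * (P b j / P q j * (1 / b) ^ j * (P2 (1 / b) (M - j) / P2 (q ^ 2) (M - j))))" if j: "j \<le> M" for j
  proof -
    have g1: "P (- (A * q * q ^ M)) (M - j) = PM * (qsign q j * c ^ j) / P c j"
      using qpochhammer_reverse_diff[of q c j M] nz j generic_nonzero[OF gc] unfolding cM PM_def by simp
    have g2: "P c j * (1 - c * q ^ j) = (1 - c) * P B j"
      using qpochhammer_shift[of c q j] by (simp add: c_def)
    have g3: "P2 (1 / b) (M - j) = P2 (1 / b) M * (qsign (q ^ 2) j * c2 ^ j) / P2 c2 j"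
      using qpochhammer_reverse_diff[of "q ^ 2" c2 j M] nz j generic_nonzero2[OF gc2] unfolding c2M by simp
    have g4: "(q * c * A) ^ j = (- 1) ^ j * ((1 / (b * q)) ^ j * c2 ^ j)"
      unfolding power_mult_distrib[symmetric] using A nz
      by (intro arg_cong[of _ _ "\<lambda>x. x ^ j"]) (simp add: c_def B_def c2_def power2_eq_square)
    have g5: "(1 / (b * q)) ^ j * q ^ j = (1 / b) ^ j"
      unfolding power_mult_distrib[symmetric] by simp
    have nzs: "P c j \<noteq> 0" "P2 c2 j \<noteq> 0" "P2 (1 / b) M \<noteq> 0"
      using generic_nonzero[OF gc] generic_nonzero2[OF gc2] generic_nonzero2[OF gb(2)] by auto
    have BP: "P B j = P c j * (1 - c * q ^ j) / (1 - c)"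
      using g2 c1 by (simp add: field_simps)
    have "P B j * qsign q j * q ^ j / (P q j * P2 c2 j) * (A ^ j * P b j * P (- (A * q * q ^ M)) (M - j) / P2 (q ^ 2) (M - j)) =
      P b j / P q j * (P B j / P c j) * (qsign q j ^ 2 * (q * c * A) ^ j / P2 c2 j) * PM / P2 (q ^ 2) (M - j)"
      unfolding g1 by (simp add: power_mult_distrib power2_eq_square mult_ac)
    also have "P B j / P c j = (1 - c * q ^ j) / (1 - c)"
      unfolding BP using nzs by simp
    also have "qsign q j ^ 2 * (q * c * A) ^ j / P2 c2 j = (1 / (b * q)) ^ j * (P2 (1 / b) (M - j) / P2 (1 / b) M)"
      unfolding g3 g4 qsign_square using nzs by (simp add: mult_ac)
    finally show ?thesis unfolding g5[symmetric] cf_def by (simp add: algebra_simps diff_divide_distrib)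
  qed
  then have "(\<Sum>j\<le>M. P B j * qsign q j * q ^ j / (P q j * P2 c2 j) * (A ^ j * P b j * P (- (A * q * q ^ M)) (M - j) / P2 (q ^ 2) (M - j))) =
     cf * (P2 b M / P2 (q ^ 2) M * (1 / (b * q)) ^ M - c * (P2 b M / P2 (q ^ 2) M * (q / b) ^ M))"
    unfolding mixed_base_convolution[OF nz(1), symmetric]
    by (simp add: sum_subtractf sum_distrib_left right_diff_distrib)
  also have "\<dots> = cf * (P2 b M / P2 (q ^ 2) M) * ((1 / (b * q)) ^ M - c * (q / b) ^ M)"
    by (simp add: right_diff_distrib diff_divide_distrib mult_ac)
  \<comment> \<open>As \<open>c\<close> equals -q^(-2M)/A, the two powers are proportional and
    combine into one.\<close>
  also have "(1 / (b * q)) ^ M - c * (q / b) ^ M = (1 / (b * q)) ^ M * ((1 + A) / A)"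
  proof -
    have "c * (q / b) ^ M = - ((1 / (b * q)) ^ M / A)"
      unfolding c_def B_def mult_2 power_add using A nz by (simp add: field_simps)
    then show ?thesis using A by (simp add: add_divide_distrib distrib_left)
  qed
  also have "cf * (P2 b M / P2 (q ^ 2) M) * ((1 / (b * q)) ^ M * ((1 + A) / A)) =
     PM / P2 (1 / b) M * (P2 b M / P2 (q ^ 2) M) * (1 / b * q) ^ M * ((1 + A) / (1 + A * q ^ (2 * M)))"
  proof -
    have e: "1 + A * q ^ (2 * M) = (1 - c) * A * q ^ (2 * M)"
      using A by (simp add: c_def B_def field_simps)
    have f: "(1 / b * q) ^ M = (1 / (b * q)) ^ M * q ^ (2 * M)"
      unfolding mult_2 power_add using nz by (simp add: field_simps)
    show ?thesis unfolding cf_def e f using A c1 by (simp add: mult_ac)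
  qed
  finally show ?thesis unfolding PM_def b_def c2_def by (simp add: mult_ac)
qed

text \<open>The case \<open>r = 0\<close> of the sum over \<open>n\<close> described at the outset.
  \<open>saalschuetz_square\<close> introduces an inner index \<open>j\<close>; after the
  interchange, \<open>shifted_6phi5_sum\<close> removes \<open>m\<close> and
  \<open>mixed_base_sum\<close> removes \<open>j\<close>.\<close>

lemma base_change_sum:
  assumes A: "A \<noteq> 0" "generic q A" "generic q (- A)"
    and K: "K \<noteq> 0" "generic q K" "generic q (- K)" "generic q (K / A)"
  shows "(\<Sum>m\<le>M. (1 - K * q ^ (2 * m)) * (A / K) ^ m * (P2 (A / K) (M - m) * P2 (A * K) (M + m)) /
       (P2 (q ^ 2) (M - m) * P2 (K ^ 2 * q ^ 2) (M + m)) * (P (K / A) m * P K m / (P q m * P (A * q) m))) =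
     (1 - K) * P (- A) (2 * M) / P (- (K * q)) (2 * M) * (A * q / K) ^ M *
     (P2 (K / A) M * P2 (A * K) M / (P2 (q ^ 2) M * P2 (A ^ 2 * q ^ 2) M))"
proof -
  define b where "b = K / A"
  \<comment> \<open>Comes from \<open>P2 (A * K) (M + m) = P2 (A * K) M * P2 X m\<close>;
    \<open>B\<close> and \<open>c2\<close> are the parameters that \<open>saalschuetz_square\<close>
    then attaches to \<open>X\<close>.\<close>
  define X where "X = A * K * q ^ (2 * M)"
  define B where "B = - (q / (A * q ^ (2 * M)))"
  define c2 where "c2 = K / A * q ^ 2 / q ^ (2 * M)"
  define D where "D = P2 (A / K) M * P2 (A * K) M"
  have X0: "X \<noteq> 0" and c20: "c2 \<noteq> 0" using A K by (auto simp: X_def c2_def)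
  have BX: "- (K * q / X) = B" and cX: "K ^ 2 * q ^ 2 / X = c2" and gX: "K ^ 2 / X = K / A / q ^ (2 * M)"
    using A K by (simp_all add: B_def X_def c2_def power2_eq_square)
  have gc2: "generic q c2"
    unfolding c2_def generic_divide_power[OF q_nonzero] generic_mult_power[OF q_nonzero] by (rule K)
  have B0: "B \<noteq> 0" using A by (simp add: B_def)
  have split: "(1 - K * q ^ (2 * m)) * (A / K) ^ m * (P2 (A / K) (M - m) * P2 (A * K) (M + m)) /
       (P2 (q ^ 2) (M - m) * P2 (K ^ 2 * q ^ 2) (M + m)) * (P b m * P K m / (P q m * P (A * q) m)) =
    D * (\<Sum>j\<le>m. P B j * qsign q j * q ^ j / (P q j * P2 c2 j) *
      ((1 - K * q ^ (2 * m)) * P b m * P K (m + j) / (P (A * q) m * P q (m - j)) *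
       (qsign (q ^ 2) m * (- (A * q)) ^ m / q ^ (m * j)) /
       (P q (M - m) * P (- q) (M - m) * P (K * q) (M + m) * P (- (K * q)) (M + m))))" (is "?l = D * ?r")
    if m: "m \<le> M" for m
  proof -
    have s1: "P2 (A / K) (M - m) = P2 (A / K) M * (qsign (q ^ 2) m * c2 ^ m) / P2 c2 m"
    proof -
      have "q ^ 2 / (c2 * (q ^ 2) ^ M) = A / K"
        using A K by (simp add: c2_def power_mult)
      then show ?thesis
        using qpochhammer_reverse_diff[of "q ^ 2" c2 m M] c20 m generic_nonzero2[OF gc2] by simp
    qed
    have s2: "P2 (A * K) (M + m) = P2 (A * K) M * P2 X m"
      unfolding qpochhammer_add X_def power_mult ..
    have s3: "P2 (q ^ 2) (M - m) = P q (M - m) * P (- q) (M - m)" by (rule qpochhammer_square)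
    have s4: "P2 (K ^ 2 * q ^ 2) (M + m) = P (K * q) (M + m) * P (- (K * q)) (M + m)"
      unfolding power_mult_distrib[symmetric] by (rule qpochhammer_square)
    have s5: "P2 X m / P2 c2 m = P q m / B ^ m *
       (\<Sum>j\<le>m. P (K * q ^ m) j * P B j * qsign q j * q ^ j / (q ^ (m * j) * P q j * P q (m - j) * P2 c2 j))"
      using saalschuetz_square[of K X m, unfolded BX cX gX generic_divide_power[OF q_nonzero]] K X0 B0 by simp
    have s6: "P K m * P (K * q ^ m) j = P K (m + j)" for j by (rule qpochhammer_add[symmetric])
    have s7: "(A / K) ^ m * c2 ^ m / B ^ m = (- (A * q)) ^ m"
      unfolding power_mult_distrib[symmetric] power_divide[symmetric] using A K
      by (intro arg_cong[of _ _ "\<lambda>x. x ^ m"]) (simp add: c2_def B_def power2_eq_square)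
    let ?g = "(1 - K * q ^ (2 * m)) * P b m / P (A * q) m * (qsign (q ^ 2) m * (- (A * q)) ^ m) /
       (P q (M - m) * P (- q) (M - m) * P (K * q) (M + m) * P (- (K * q)) (M + m))"
    have "?l = D * ((1 - K * q ^ (2 * m)) * P b m / P (A * q) m * (qsign (q ^ 2) m * ((A / K) ^ m * c2 ^ m)) /
       (P q (M - m) * P (- q) (M - m) * P (K * q) (M + m) * P (- (K * q)) (M + m))) * (P K m / P q m * (P2 X m / P2 c2 m))"
      unfolding s1 s2 s3 s4 D_def by (simp add: mult_ac)
    also have "\<dots> = D * ?g * (P K m *
       (\<Sum>j\<le>m. P (K * q ^ m) j * P B j * qsign q j * q ^ j / (q ^ (m * j) * P q j * P q (m - j) * P2 c2 j)))"
      unfolding s5 s7[symmetric] by (simp add: mult_ac)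
    also have "\<dots> = D * (?g *
       (\<Sum>j\<le>m. P K (m + j) * P B j * qsign q j * q ^ j / (q ^ (m * j) * P q j * P q (m - j) * P2 c2 j)))"
      unfolding s6[symmetric] sum_distrib_left by (simp add: mult_ac)
    also have "\<dots> = D * ?r"
      unfolding sum_distrib_left by (intro sum.cong refl) (simp add: mult_ac)
    finally show ?thesis .
  qed
  have "(\<Sum>m\<le>M. (1 - K * q ^ (2 * m)) * (A / K) ^ m * (P2 (A / K) (M - m) * P2 (A * K) (M + m)) /
       (P2 (q ^ 2) (M - m) * P2 (K ^ 2 * q ^ 2) (M + m)) * (P b m * P K m / (P q m * P (A * q) m))) =
    D * (\<Sum>m\<le>M. \<Sum>j\<le>m. P B j * qsign q j * q ^ j / (P q j * P2 c2 j) *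
      ((1 - K * q ^ (2 * m)) * P b m * P K (m + j) / (P (A * q) m * P q (m - j)) *
       (qsign (q ^ 2) m * (- (A * q)) ^ m / q ^ (m * j)) /
       (P q (M - m) * P (- q) (M - m) * P (K * q) (M + m) * P (- (K * q)) (M + m))))"
    using split by (simp add: sum_distrib_left[symmetric])
  also have "\<dots> = D * (\<Sum>j\<le>M. P B j * qsign q j * q ^ j / (P q j * P2 c2 j) *
      ((1 - K) * A ^ j * P b j * P (- (A * q * q ^ M)) (M - j) /
       (P2 (q ^ 2) (M - j) * P (A * q) M * P (- (K * q)) (2 * M))))"
    unfolding sum_triangle_swap b_def sum_distrib_left[symmetric]
    using shifted_6phi5_sum[OF _ A(1,2) K(1-3)] by simp
  also have "\<dots> = D * ((1 - K) / (P (A * q) M * P (- (K * q)) (2 * M))) *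
     (\<Sum>j\<le>M. P B j * qsign q j * q ^ j / (P q j * P2 c2 j) *
       (A ^ j * P b j * P (- (A * q * q ^ M)) (M - j) / P2 (q ^ 2) (M - j)))"
    unfolding sum_distrib_left by (intro sum.cong refl) (simp add: mult_ac)
  also have "\<dots> = D * ((1 - K) / (P (A * q) M * P (- (K * q)) (2 * M))) *
     (P (- (A * q * q ^ M)) M / P2 (A / K) M * (P2 (K / A) M / P2 (q ^ 2) M) * (A * q / K) ^ M *
     ((1 + A) / (1 + A * q ^ (2 * M))))"
    using mixed_base_sum[OF A(1,3) K(1,4), of M] by (simp add: B_def c2_def b_def)
  also have "\<dots> = (1 - K) * P (- A) (2 * M) / P (- (K * q)) (2 * M) * (A * q / K) ^ M *
     (P2 (K / A) M * P2 (A * K) M / (P2 (q ^ 2) M * P2 (A ^ 2 * q ^ 2) M))"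
  proof -
    have nz1: "P2 (A / K) M \<noteq> 0"
      using generic_nonzero2[of q "1 / (K / A)" M] generic_inverse[of "K / A" q] A K by simp
    have sq: "P2 (A ^ 2 * q ^ 2) M = P (A * q) M * P (- (A * q)) M"
      unfolding power_mult_distrib[symmetric] by (rule qpochhammer_square)
    have nz2: "P (- (A * q)) M \<noteq> 0" using A by (intro generic_nonzero) simp
    have nz3: "1 + A * q ^ (2 * M) \<noteq> 0"
      using genericD[OF A(3), of "2 * M" 0] by (auto simp: add_eq_0_iff)
    \<comment> \<open>The quotient \<open>(1 + A) / (1 + A * q ^ (2 * M))\<close> moves the
      parameter of the factor of length \<open>2 * M\<close> from \<open>- (A * q)\<close> to
      \<open>- A\<close>.\<close>
    have "P (- A) (2 * M) * (1 + A * q ^ (2 * M)) = (1 + A) * (P (- (A * q)) M * P (- (A * q * q ^ M)) M)"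
      using qpochhammer_shift[of "- A" q "2 * M"] qpochhammer_add[of "- (A * q)" q M M] by (simp add: mult_2)
    then have num: "P (- A) (2 * M) = (1 + A) * (P (- (A * q)) M * P (- (A * q * q ^ M)) M) / (1 + A * q ^ (2 * M))"
      using nz3 by (simp only: eq_divide_eq not_False_eq_True if_True)
    show ?thesis unfolding D_def sq num using nz1 nz2 by (simp add: mult_ac)
  qed
  finally show ?thesis unfolding b_def .
qed

text \<open>Multiplying \<open>a\<close> and \<open>k\<close> by \<open>q ^ (2 * r)\<close> and
  replacing \<open>N\<close> by \<open>N - r\<close> keeps the ratio of the two parameters and
  reduces the sum to \<open>base_change_sum\<close>; the longer products are split after
  \<open>2 * r\<close> factors.\<close>

lemma base_change_sum_shifted:
  assumes r: "r \<le> N" and a: "a \<noteq> 0" "generic q a" "generic q (- a)"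
    and k: "k \<noteq> 0" "generic q k" "generic q (- k)" "generic q (k / a)"
  shows "(\<Sum>m\<le>N - r. (1 - k * q ^ (2 * (r + m))) * (a / k) ^ (r + m) *
       (P2 (a / k) (N - (r + m)) * P2 (a * k) (N + (r + m))) /
       (P2 (q ^ 2) (N - (r + m)) * P2 (k ^ 2 * q ^ 2) (N + (r + m))) *
       (P (k / a) m * P k (r + m + r) / (P q m * P (a * q) (r + m + r)))) =
     (1 - k) * P (- a) (2 * N) / P (- (k * q)) (2 * N) * (a * q / k) ^ N * (1 / q) ^ r *
     ((1 + a * q ^ (2 * r)) / (1 + a)) *
     (P2 (k / a) (N - r) * P2 (a * k) (N + r) / (P2 (q ^ 2) (N - r) * P2 (a ^ 2 * q ^ 2) (N + r)))"
proof -
  define A K M where "A = a * q ^ (2 * r)" and "K = k * q ^ (2 * r)" and "M = N - r"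
  have N: "N = r + M" using r by (simp add: M_def)
  have nz: "A \<noteq> 0" "K \<noteq> 0" using a k by (simp_all add: A_def K_def)
  have g: "generic q A" "generic q (- A)" "generic q K" "generic q (- K)" "generic q (K / A)"
    using a k generic_mult_power[of q "- a" "2 * r"] generic_mult_power[of q "- k" "2 * r"]
    by (simp_all add: A_def K_def)
  have AK: "A / K = a / k" "K / A = k / a" "A * q / K = a * q / k"
    by (simp_all add: A_def K_def)
  have sq: "A * K = a * k * (q ^ 2) ^ (2 * r)" "K ^ 2 * q ^ 2 = k ^ 2 * q ^ 2 * (q ^ 2) ^ (2 * r)"
      "A ^ 2 * q ^ 2 = a ^ 2 * q ^ 2 * (q ^ 2) ^ (2 * r)"
    unfolding A_def K_def by (simp_all add: power2_eq_square power_mult_distrib)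
  have e: "N + (r + m) = 2 * r + (M + m)" "r + m + r = 2 * r + m" "N + r = 2 * r + M"
      "2 * N = 2 * r + 2 * M" for m
    by (simp_all add: N)
  have Aq: "A * q = a * q * q ^ (2 * r)" "- (K * q) = - (k * q) * q ^ (2 * r)" "- A = - a * q ^ (2 * r)"
    by (simp_all add: A_def K_def)
  have s1: "P2 (a * k) (N + (r + m)) = P2 (a * k) (2 * r) * P2 (A * K) (M + m)"
    and s2: "P2 (k ^ 2 * q ^ 2) (N + (r + m)) = P2 (k ^ 2 * q ^ 2) (2 * r) * P2 (K ^ 2 * q ^ 2) (M + m)"
    and s4: "P (a * q) (r + m + r) = P (a * q) (2 * r) * P (A * q) m" for m
    by (simp_all only: e sq Aq qpochhammer_add)
  have s3: "P k (r + m + r) = P k (2 * r) * P K m" for m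
    unfolding e K_def by (rule qpochhammer_add)
  define cf where "cf = (a / k) ^ r * P2 (a * k) (2 * r) * P k (2 * r) / (P2 (k ^ 2 * q ^ 2) (2 * r) * P (a * q) (2 * r))"
  have "(\<Sum>m\<le>N - r. (1 - k * q ^ (2 * (r + m))) * (a / k) ^ (r + m) *
       (P2 (a / k) (N - (r + m)) * P2 (a * k) (N + (r + m))) /
       (P2 (q ^ 2) (N - (r + m)) * P2 (k ^ 2 * q ^ 2) (N + (r + m))) *
       (P (k / a) m * P k (r + m + r) / (P q m * P (a * q) (r + m + r)))) =
    cf * (\<Sum>m\<le>M. (1 - K * q ^ (2 * m)) * (A / K) ^ m * (P2 (A / K) (M - m) * P2 (A * K) (M + m)) /
       (P2 (q ^ 2) (M - m) * P2 (K ^ 2 * q ^ 2) (M + m)) * (P (K / A) m * P K m / (P q m * P (A * q) m)))"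
    unfolding sum_distrib_left M_def[symmetric] s1 s2 s3 s4 AK cf_def
    by (intro sum.cong refl) (simp add: M_def K_def power_add distrib_left mult_ac)
  also have "\<dots> = cf * ((1 - K) * P (- A) (2 * M) / P (- (K * q)) (2 * M) * (A * q / K) ^ M *
     (P2 (K / A) M * P2 (A * K) M / (P2 (q ^ 2) M * P2 (A ^ 2 * q ^ 2) M)))"
    using base_change_sum[OF nz(1) g(1,2) nz(2) g(3,4,5), of M] by simp
  also have "\<dots> = (1 - k) * P (- a) (2 * N) / P (- (k * q)) (2 * N) * (a * q / k) ^ N * (1 / q) ^ r *
     ((1 + a * q ^ (2 * r)) / (1 + a)) *
     (P2 (k / a) M * P2 (a * k) (N + r) / (P2 (q ^ 2) M * P2 (a ^ 2 * q ^ 2) (N + r)))"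
  proof -
    have t1: "P2 (a * k) (N + r) = P2 (a * k) (2 * r) * P2 (A * K) M"
      "P2 (a ^ 2 * q ^ 2) (N + r) = P2 (a ^ 2 * q ^ 2) (2 * r) * P2 (A ^ 2 * q ^ 2) M"
      by (simp_all only: e sq qpochhammer_add)
    have t2: "P (- (k * q)) (2 * N) = P (- (k * q)) (2 * r) * P (- (K * q)) (2 * M)"
        "P (- a) (2 * N) = P (- a) (2 * r) * P (- A) (2 * M)"
      by (simp_all only: e Aq qpochhammer_add)
    have t3: "P2 (k ^ 2 * q ^ 2) (2 * r) = P (k * q) (2 * r) * P (- (k * q)) (2 * r)"
      "P2 (a ^ 2 * q ^ 2) (2 * r) = P (a * q) (2 * r) * P (- (a * q)) (2 * r)"
      unfolding power_mult_distrib[symmetric] by (simp_all only: qpochhammer_square)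
    have t4: "P k (2 * r) * (1 - K) = (1 - k) * P (k * q) (2 * r)"
      "(1 + a) * P (- (a * q)) (2 * r) = P (- a) (2 * r) * (1 + A)"
      using qpochhammer_shift[of k q "2 * r"] qpochhammer_shift[of "- a" q "2 * r"] by (simp_all add: K_def A_def)
    have t5: "(a / k) ^ r * (a * q / k) ^ M = (a * q / k) ^ N * (1 / q) ^ r"
      unfolding N power_add by (simp add: power_mult_distrib power_divide)
    have nzP: "P (k * q) (2 * r) \<noteq> 0" "P (- (a * q)) (2 * r) \<noteq> 0"
      using a k by (auto intro!: generic_nonzero)
    have nz1: "1 + a \<noteq> 0" using genericD[OF a(3), of 0 0] by (auto simp: add_eq_0_iff)
    have t6: "P (- a) (2 * r) * (1 + A) / (1 + a) = P (- (a * q)) (2 * r)"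
      unfolding t4(2)[symmetric] using nz1 by simp
    have "cf * ((1 - K) * P (- A) (2 * M) / P (- (K * q)) (2 * M) * (A * q / K) ^ M *
     (P2 (K / A) M * P2 (A * K) M / (P2 (q ^ 2) M * P2 (A ^ 2 * q ^ 2) M))) =
     ((a / k) ^ r * (a * q / k) ^ M) * (P k (2 * r) * (1 - K)) * P2 (a * k) (2 * r) / (P2 (k ^ 2 * q ^ 2) (2 * r) * P (a * q) (2 * r))
       * (P (- A) (2 * M) / P (- (K * q)) (2 * M) *
     (P2 (k / a) M * P2 (A * K) M / (P2 (q ^ 2) M * P2 (A ^ 2 * q ^ 2) M)))"
      unfolding cf_def AK by (simp add: mult_ac)
    also have "\<dots> = (1 - k) * (a * q / k) ^ N * (1 / q) ^ r * P2 (a * k) (2 * r) / (P (- (k * q)) (2 * r) * P (a * q) (2 * r))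
       * (P (- A) (2 * M) / P (- (K * q)) (2 * M) *
     (P2 (k / a) M * P2 (A * K) M / (P2 (q ^ 2) M * P2 (A ^ 2 * q ^ 2) M)))"
      unfolding t4 t5 t3 using nzP by (simp add: mult_ac)
    also have "\<dots> = (1 - k) * (P (- a) (2 * r) * (1 + A) / (1 + a)) * P (- A) (2 * M) / P (- (k * q)) (2 * N) * (a * q / k) ^ N * (1 / q) ^ r *
     (P2 (k / a) M * P2 (a * k) (N + r) / (P2 (q ^ 2) M * P2 (a ^ 2 * q ^ 2) (N + r)))"
      unfolding t6 t1 t2 t3 using nzP by (simp add: mult_ac)
    finally show ?thesis unfolding t2(2) A_def by (simp add: mult_ac)
  qed
  finally show ?thesis unfolding M_def .
qed

section \<open>From kernels to the two series, for generic parameters\<close>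

text \<open>Reversing the factors of length \<open>N - n\<close> writes the kernel as its value at
  \<open>n = 0\<close> times a hypergeometric term; the terminating parameter
  \<open>1 / q ^ (2 * N)\<close> arises from \<open>P2 (q ^ 2) (N - n)\<close>.\<close>

lemma kernel_factorization:
  assumes D: "D \<noteq> 0" "generic q D" and n: "n \<le> N"
  shows "D ^ n * (P2 D (N - n) * P2 E (N + n) / (P2 (q ^ 2) (N - n) * P2 F (N + n))) =
    P2 D N * P2 E N / (P2 (q ^ 2) N * P2 F N) *
    (P2 (E * q ^ (2 * N)) n * P2 (1 / q ^ (2 * N)) n /
     (P2 (q ^ 2 / (D * q ^ (2 * N))) n * P2 (F * q ^ (2 * N)) n) * (q ^ 2) ^ n)"
proof -
  define c where "c = q ^ 2 / (D * q ^ (2 * N))"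
  define d where "d = 1 / q ^ (2 * N)"
  have nz: "c \<noteq> 0" "d \<noteq> 0" using D by (auto simp: c_def d_def)
  have "c = 1 / D * q ^ 2 / q ^ (2 * N)" by (simp add: c_def)
  moreover have "generic q (1 / D)" using D by (simp add: generic_inverse)
  ultimately have gc: "generic q c"
    by (simp only: generic_divide_power[OF q_nonzero] generic_mult_power[OF q_nonzero])
  have cN: "q ^ 2 / (c * (q ^ 2) ^ N) = D" and dN: "q ^ 2 / (d * (q ^ 2) ^ N) = q ^ 2"
    by (simp_all add: c_def d_def power_mult)
  \<comment> \<open>Since \<open>d\<close> is a power of \<open>q\<close>, genericity is of no help
    here; its only vanishing factor has index \<open>N\<close>, which \<open>n \<le> N\<close> keeps
    out of the product.\<close>
  have dnz: "P2 d n \<noteq> 0"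
  proof
    assume "P2 d n = 0"
    then obtain i where i: "i < n" "d * (q ^ 2) ^ i = 1" by (auto simp: qpochhammer_eq_0_iff)
    then have "q ^ (2 * i) = q ^ (2 * N)"
      unfolding d_def power_mult[symmetric] by simp
    moreover have "2 * N = 2 * i + 2 * (N - i)" using i n by simp
    then have "q ^ (2 * N) = q ^ (2 * i) * q ^ (2 * (N - i))"
      by (metis power_add)
    ultimately have "q ^ (2 * (N - i)) = 1" by simp
    then show False using q_power[of "2 * (N - i)"] i n by simp
  qed
  have 1: "P2 D (N - n) = P2 D N * (qsign (q ^ 2) n * c ^ n) / P2 c n"
    using qpochhammer_reverse_diff[of "q ^ 2" c n N] nz n generic_nonzero2[OF gc] unfolding cN by simp
  have 2: "P2 (q ^ 2) (N - n) = P2 (q ^ 2) N * (qsign (q ^ 2) n * d ^ n) / P2 d n"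
    using qpochhammer_reverse_diff[of "q ^ 2" d n N] nz n dnz unfolding dN by simp
  have 3: "P2 x (N + n) = P2 x N * P2 (x * q ^ (2 * N)) n" for x
    unfolding power_mult by (rule qpochhammer_add)
  have "D * c = q ^ 2 * d" using D by (simp add: c_def d_def)
  then have 4: "D ^ n * c ^ n = (q ^ 2) ^ n * d ^ n" by (simp only: power_mult_distrib[symmetric])
  have nz2: "qsign (q ^ 2) n \<noteq> 0" "d ^ n \<noteq> 0" using nz by simp_all
  have "D ^ n * (P2 D (N - n) * P2 E (N + n) / (P2 (q ^ 2) (N - n) * P2 F (N + n))) =
      (D ^ n * c ^ n) * (P2 D N / P2 c n * P2 E (N + n) / (P2 (q ^ 2) N * d ^ n / P2 d n * P2 F (N + n)))"
    unfolding 1 2 using nz nz2 by (simp add: mult_ac)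
  also have "\<dots> = (q ^ 2) ^ n * (P2 D N / P2 c n * P2 E (N + n) / (P2 (q ^ 2) N / P2 d n * P2 F (N + n)))"
    unfolding 4 using nz nz2 by (simp add: mult_ac)
  finally show ?thesis unfolding 3 c_def d_def by (simp add: mult_ac)
qed

text \<open>\<open>saalschuetz_bailey_pair\<close> inserts a sum over \<open>r\<close>; after the
  interchange, \<open>base_change_sum_shifted\<close> evaluates the sum over
  \<open>m = n - r\<close>.\<close>

lemma kernel_transformation:
  assumes a: "a \<noteq> 0" "generic q a" "generic q (- a)"
    and k: "k \<noteq> 0" "generic q k" "generic q (- k)" "generic q (k / a)"
  shows "(\<Sum>n\<le>N. (1 - k * q ^ (2 * n)) * (a / k) ^ n *
       (P2 (a / k) (N - n) * P2 (a * k) (N + n)) / (P2 (q ^ 2) (N - n) * P2 (k ^ 2 * q ^ 2) (N + n)) *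
       (P k n * P (a * q / k) n * P (k ^ 2 * q ^ n / a) n / (P q n * P (a * q) (2 * n)))) =
     (1 - k) * P (- a) (2 * N) / P (- (k * q)) (2 * N) * (a * q / k) ^ N *
     (\<Sum>r\<le>N. (1 / q) ^ r * (k / a) ^ r * ((1 + a * q ^ (2 * r)) / (1 + a)) *
       (P2 (k / a) (N - r) * P2 (a * k) (N + r) / (P2 (q ^ 2) (N - r) * P2 (a ^ 2 * q ^ 2) (N + r))) *
       (P (a ^ 2 * q / k ^ 2) r / P q r))"
proof -
  let ?f = "\<lambda>n. (1 - k * q ^ (2 * n)) * (a / k) ^ n *
       (P2 (a / k) (N - n) * P2 (a * k) (N + n)) / (P2 (q ^ 2) (N - n) * P2 (k ^ 2 * q ^ 2) (N + n))"
  let ?g = "\<lambda>r. (k / a) ^ r * (P (a ^ 2 * q / k ^ 2) r / P q r)"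
  have "(\<Sum>n\<le>N. ?f n * (P k n * P (a * q / k) n * P (k ^ 2 * q ^ n / a) n / (P q n * P (a * q) (2 * n)))) =
    (\<Sum>n\<le>N. \<Sum>r\<le>n. ?f n * (P (k / a) (n - r) * P k (n + r) / (P q (n - r) * P (a * q) (n + r)) * ?g r))"
    unfolding saalschuetz_bailey_pair[OF a(1) k(1) a(2), symmetric] sum_distrib_left by (simp only: mult.assoc)
  also have "\<dots> = (\<Sum>r\<le>N. ?g r * (\<Sum>m\<le>N - r. ?f (r + m) *
       (P (k / a) m * P k (r + m + r) / (P q m * P (a * q) (r + m + r)))))"
    unfolding sum_triangle_swap sum_distrib_left
    by (intro sum.cong refl) (simp only: diff_add_inverse mult_ac)
  also have "\<dots> = (\<Sum>r\<le>N. ?g r * ((1 - k) * P (- a) (2 * N) / P (- (k * q)) (2 * N) * (a * q / k) ^ N * (1 / q) ^ r *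
     ((1 + a * q ^ (2 * r)) / (1 + a)) *
     (P2 (k / a) (N - r) * P2 (a * k) (N + r) / (P2 (q ^ 2) (N - r) * P2 (a ^ 2 * q ^ 2) (N + r)))))"
    using base_change_sum_shifted[OF _ a k] by (intro sum.cong refl) simp
  finally show ?thesis unfolding sum_distrib_left by (simp add: mult_ac)
qed

text \<open>\<open>kernel_factorization\<close> recognizes both sides of
  \<open>kernel_transformation\<close> as multiples of the two sums. Genericity of
  \<open>a * k\<close> allows division by the common constant \<open>P2 (a * k) N\<close>.\<close>

lemma generic_identity:
  assumes a: "a \<noteq> 0" "generic q a" "generic q (- a)"
    and k: "k \<noteq> 0" "generic q k" "generic q (- k)" "generic q (k / a)" and ak: "generic q (a * k)"
  shows "lhs_sum N q a k = prefactor N q a k * rhs_sum N q a k"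
proof -
  let ?c = "\<lambda>x. P2 x N * P2 (a * k) N / P2 (q ^ 2) N"
  have kern: "?c (a / k) / P2 (k ^ 2 * q ^ 2) N * ((1 - k) * lhs_sum N q a k) =
     (1 - k) * P (- a) (2 * N) / P (- (k * q)) (2 * N) * (a * q / k) ^ N *
     (?c (k / a) / P2 (a ^ 2 * q ^ 2) N * rhs_sum N q a k)"
  proof -
    have g: "generic q (a / k)" using generic_inverse[of "k / a" q] a k by simp
    have "?c (a / k) / P2 (k ^ 2 * q ^ 2) N * ((1 - k) * lhs_sum N q a k) =
      (\<Sum>n\<le>N. (1 - k * q ^ (2 * n)) * (a / k) ^ n *
       (P2 (a / k) (N - n) * P2 (a * k) (N + n)) / (P2 (q ^ 2) (N - n) * P2 (k ^ 2 * q ^ 2) (N + n)) *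
       (P k n * P (a * q / k) n * P (k ^ 2 * q ^ n / a) n / (P q n * P (a * q) (2 * n))))"
      unfolding lhs_sum_def sum_distrib_left
    proof (intro sum.cong refl)
      fix n assume "n \<in> {..N}"
      then have n: "n \<le> N" by simp
      let ?b = "P k n * P (a * q / k) n * P (k ^ 2 * q ^ n / a) n / (P q n * P (a * q) (2 * n))"
      let ?u = "P2 (a * k * q ^ (2 * N)) n * P2 (1 / q ^ (2 * N)) n /
        (P2 (q ^ 2 / (a / k * q ^ (2 * N))) n * P2 (k ^ 2 * q ^ 2 * q ^ (2 * N)) n) * (q ^ 2) ^ n"
      have e: "q ^ 2 / (a / k * q ^ (2 * N)) = k * q ^ 2 / (a * q ^ (2 * N))" by (simp add: mult.commute)
      have k1: "1 - k \<noteq> 0" using genericD[OF k(2), of 0 0] by simp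
      have "(1 - k * q ^ (2 * n)) * (a / k) ^ n *
       (P2 (a / k) (N - n) * P2 (a * k) (N + n)) / (P2 (q ^ 2) (N - n) * P2 (k ^ 2 * q ^ 2) (N + n)) * ?b =
       (1 - k * q ^ (2 * n)) * ?b * ((a / k) ^ n * (P2 (a / k) (N - n) * P2 (a * k) (N + n) /
         (P2 (q ^ 2) (N - n) * P2 (k ^ 2 * q ^ 2) (N + n))))"
        by (simp add: mult_ac)
      also have "\<dots> = (1 - k * q ^ (2 * n)) * ?b * (?c (a / k) / P2 (k ^ 2 * q ^ 2) N * ?u)"
        using kernel_factorization[OF _ g n, of "a * k" "k ^ 2 * q ^ 2"] a k by simp
      finally show "?c (a / k) / P2 (k ^ 2 * q ^ 2) N * ((1 - k) * ((1 - k * q ^ (2 * n)) / (1 - k) *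
     (P k n * P (q * a / k) n * P (k ^ 2 * q ^ n / a) n * P2 (a * k * q ^ (2 * N)) n * P2 (1 / q ^ (2 * N)) n) /
     (P q n * P (a * q) (2 * n) * P2 (k * q ^ 2 / (a * q ^ (2 * N))) n *
      P2 (k ^ 2 * q ^ 2 * q ^ (2 * N)) n) * (q ^ 2) ^ n)) =
       (1 - k * q ^ (2 * n)) * (a / k) ^ n *
       (P2 (a / k) (N - n) * P2 (a * k) (N + n)) / (P2 (q ^ 2) (N - n) * P2 (k ^ 2 * q ^ 2) (N + n)) * ?b"
        unfolding e using k1 by (simp add: mult_ac)
    qed
    also have "\<dots> = (1 - k) * P (- a) (2 * N) / P (- (k * q)) (2 * N) * (a * q / k) ^ N *
     (\<Sum>r\<le>N. (1 / q) ^ r * (k / a) ^ r * ((1 + a * q ^ (2 * r)) / (1 + a)) *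
       (P2 (k / a) (N - r) * P2 (a * k) (N + r) / (P2 (q ^ 2) (N - r) * P2 (a ^ 2 * q ^ 2) (N + r))) *
       (P (a ^ 2 * q / k ^ 2) r / P q r))"
      by (rule kernel_transformation[OF a k])
    also have "(\<Sum>r\<le>N. (1 / q) ^ r * (k / a) ^ r * ((1 + a * q ^ (2 * r)) / (1 + a)) *
       (P2 (k / a) (N - r) * P2 (a * k) (N + r) / (P2 (q ^ 2) (N - r) * P2 (a ^ 2 * q ^ 2) (N + r))) *
       (P (a ^ 2 * q / k ^ 2) r / P q r)) = ?c (k / a) / P2 (a ^ 2 * q ^ 2) N * rhs_sum N q a k"
      unfolding rhs_sum_def sum_distrib_left
    proof (intro sum.cong refl)
      fix r assume "r \<in> {..N}"
      then have r: "r \<le> N" by simp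
      let ?b = "(1 + a * q ^ (2 * r)) / (1 + a) * (P (a ^ 2 * q / k ^ 2) r / P q r)"
      let ?u = "P2 (a * k * q ^ (2 * N)) r * P2 (1 / q ^ (2 * N)) r /
        (P2 (q ^ 2 / (k / a * q ^ (2 * N))) r * P2 (a ^ 2 * q ^ 2 * q ^ (2 * N)) r)"
      have e: "q ^ 2 / (k / a * q ^ (2 * N)) = a * q ^ 2 / (k * q ^ (2 * N))" by (simp add: mult.commute)
      \<comment> \<open>The power of \<open>1 / q\<close> from the inner sum lowers the argument
        \<open>q ^ 2\<close> of the kernel to the argument \<open>q\<close> of the 7phi6.\<close>
      have qr: "(1 / q) ^ r * (q ^ 2) ^ r = q ^ r"
        unfolding power_mult_distrib[symmetric] by (simp add: power2_eq_square)
      have "(1 / q) ^ r * (k / a) ^ r * ((1 + a * q ^ (2 * r)) / (1 + a)) *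
       (P2 (k / a) (N - r) * P2 (a * k) (N + r) / (P2 (q ^ 2) (N - r) * P2 (a ^ 2 * q ^ 2) (N + r))) *
       (P (a ^ 2 * q / k ^ 2) r / P q r) = (1 / q) ^ r * ?b * ((k / a) ^ r *
         (P2 (k / a) (N - r) * P2 (a * k) (N + r) / (P2 (q ^ 2) (N - r) * P2 (a ^ 2 * q ^ 2) (N + r))))"
        by (simp add: mult_ac)
      also have "\<dots> = (1 / q) ^ r * ?b * (?c (k / a) / P2 (a ^ 2 * q ^ 2) N * (?u * (q ^ 2) ^ r))"
        using kernel_factorization[OF _ k(4) r, of "a * k" "a ^ 2 * q ^ 2"] a k by simp
      also have "\<dots> = ((1 / q) ^ r * (q ^ 2) ^ r) * ?b * (?c (k / a) / P2 (a ^ 2 * q ^ 2) N * ?u)"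
        by (simp only: mult_ac)
      finally show "(1 / q) ^ r * (k / a) ^ r * ((1 + a * q ^ (2 * r)) / (1 + a)) *
       (P2 (k / a) (N - r) * P2 (a * k) (N + r) / (P2 (q ^ 2) (N - r) * P2 (a ^ 2 * q ^ 2) (N + r))) *
       (P (a ^ 2 * q / k ^ 2) r / P q r) =
       ?c (k / a) / P2 (a ^ 2 * q ^ 2) N * ((1 + a * q ^ (2 * r)) / (1 + a) *
         (P (a ^ 2 * q / k ^ 2) r * P2 (a * k * q ^ (2 * N)) r * P2 (1 / q ^ (2 * N)) r) /
     (P q r * P2 (a ^ 2 * q ^ 2 * q ^ (2 * N)) r * P2 (a * q ^ 2 / (k * q ^ (2 * N))) r) * q ^ r)"
        unfolding e qr by (simp add: mult_ac)
    qed
    finally show ?thesis .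
  qed
  have nz: "1 - k \<noteq> 0" "P2 (a * k) N \<noteq> 0" "P2 (a / k) N \<noteq> 0" "P2 (k ^ 2 * q ^ 2) N \<noteq> 0"
  proof -
    show "1 - k \<noteq> 0" using genericD[OF k(2), of 0 0] by simp
    show "P2 (a * k) N \<noteq> 0" by (rule generic_nonzero2[OF ak])
    show "P2 (a / k) N \<noteq> 0"
      using generic_nonzero2[of q "1 / (k / a)" N] generic_inverse[of "k / a" q] a k by simp
    show "P2 (k ^ 2 * q ^ 2) N \<noteq> 0"
      unfolding power_mult_distrib[symmetric] qpochhammer_square using k by (simp add: generic_nonzero)
  qed
  have "lhs_sum N q a k = ?c (a / k) / P2 (k ^ 2 * q ^ 2) N * ((1 - k) * lhs_sum N q a k) /
      (?c (a / k) / P2 (k ^ 2 * q ^ 2) N * (1 - k))"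
    using nz by simp
  also have "\<dots> = prefactor N q a k * rhs_sum N q a k"
    unfolding kern prefactor_def using nz by (simp add: mult_ac)
  finally show ?thesis .
qed

end

section \<open>Removing genericity by continuity\<close>

lemma tendsto_qpochhammer [tendsto_intros]:
  "(x \<longlongrightarrow> x0) F \<Longrightarrow> (t \<longlongrightarrow> t0) F \<Longrightarrow>
     ((\<lambda>s. qpochhammer (x s) (t s) n) \<longlongrightarrow> qpochhammer x0 t0 n) F"
  unfolding qpochhammer_def by (intro tendsto_intros)

lemma tendsto_lhs_sum:
  assumes lim: "(q \<longlongrightarrow> q0) F" "(a \<longlongrightarrow> a0) F" "(k \<longlongrightarrow> k0) F"
    and nz: "q0 \<noteq> 0" "a0 \<noteq> 0" "k0 \<noteq> 0" "1 - k0 \<noteq> 0"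
    and den: "\<And>n. n \<le> N \<Longrightarrow> qpochhammer q0 q0 n * qpochhammer (a0 * q0) q0 (2 * n) *
      qpochhammer (k0 * q0 ^ 2 / (a0 * q0 ^ (2 * N))) (q0 ^ 2) n *
      qpochhammer (k0 ^ 2 * q0 ^ 2 * q0 ^ (2 * N)) (q0 ^ 2) n \<noteq> 0"
  shows "((\<lambda>s. lhs_sum N (q s) (a s) (k s)) \<longlongrightarrow> lhs_sum N q0 a0 k0) F"
  unfolding lhs_sum_def by (intro tendsto_intros lim; use nz den in simp)

lemma tendsto_rhs_sum:
  assumes lim: "(q \<longlongrightarrow> q0) F" "(a \<longlongrightarrow> a0) F" "(k \<longlongrightarrow> k0) F"
    and nz: "q0 \<noteq> 0" "a0 \<noteq> 0" "k0 \<noteq> 0" "1 + a0 \<noteq> 0"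
    and den: "\<And>n. n \<le> N \<Longrightarrow> qpochhammer q0 q0 n * qpochhammer (a0 ^ 2 * q0 ^ 2 * q0 ^ (2 * N)) (q0 ^ 2) n *
      qpochhammer (a0 * q0 ^ 2 / (k0 * q0 ^ (2 * N))) (q0 ^ 2) n \<noteq> 0"
  shows "((\<lambda>s. rhs_sum N (q s) (a s) (k s)) \<longlongrightarrow> rhs_sum N q0 a0 k0) F"
  unfolding rhs_sum_def by (intro tendsto_intros lim; use nz den in simp)

lemma tendsto_prefactor:
  assumes lim: "(q \<longlongrightarrow> q0) F" "(a \<longlongrightarrow> a0) F" "(k \<longlongrightarrow> k0) F"
    and nz: "a0 \<noteq> 0" "k0 \<noteq> 0"
    and den: "qpochhammer (a0 / k0) (q0 ^ 2) N * qpochhammer (a0 ^ 2 * q0 ^ 2) (q0 ^ 2) N *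
      qpochhammer (- (k0 * q0)) q0 (2 * N) \<noteq> 0"
  shows "((\<lambda>s. prefactor N (q s) (a s) (k s)) \<longlongrightarrow> prefactor N q0 a0 k0) F"
  unfolding prefactor_def by (intro tendsto_intros lim; use nz den in simp)

lemma finite_real_agreement:
  fixes p r :: "complex poly"
  assumes "poly p z \<noteq> poly r z"
  shows "finite {t :: real. poly p (of_real t) = poly r (of_real t)}"
proof -
  have "p - r \<noteq> 0" using assms by auto
  then have "finite {x. poly (p - r) x = 0}" by (rule poly_roots_finite)
  then have "finite (of_real -` {x. poly (p - r) x = 0} :: real set)"
    by (rule finite_vimageI) (simp add: inj_of_real)
  moreover have "of_real -` {x. poly (p - r) x = 0} = {t :: real. poly p (of_real t) = poly r (of_real t)}"
    by auto
  ultimately show ?thesis by simp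
qed

text \<open>The linear factors 1 + t, 1 + 2t and 1 + 3t have different roots, so no monomial relation
  between the three perturbed parameters holds identically in t.\<close>

lemma generic_perturbation:
  fixes q a k :: complex
  assumes nz: "q \<noteq> 0" "a \<noteq> 0" "k \<noteq> 0"
  defines "Q \<equiv> \<lambda>t :: real. q * (1 + of_real t)"
    and "A \<equiv> \<lambda>t :: real. a * (1 + 2 * of_real t)"
    and "K \<equiv> \<lambda>t :: real. k * (1 + 3 * of_real t)"
  obtains S where "countable S"
    and "\<And>t. t \<notin> S \<Longrightarrow> generic_base (Q t) \<and> A t \<noteq> 0 \<and> K t \<noteq> 0 \<and>
      generic (Q t) (A t) \<and> generic (Q t) (- A t) \<and> generic (Q t) (K t) \<and> generic (Q t) (- K t) \<and>
      generic (Q t) (K t / A t) \<and> generic (Q t) (A t * K t)"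
proof
  define q1 a1 k1 where "q1 = [:q, q:]" and "a1 = [:a, 2 * a:]" and "k1 = [:k, 3 * k:]"
  have ev: "poly q1 (of_real t) = Q t" "poly a1 (of_real t) = A t" "poly k1 (of_real t) = K t" for t :: real
    by (simp_all add: q1_def a1_def k1_def Q_def A_def K_def algebra_simps)
  define Z where "Z p r = {t :: real. poly p (of_real t) = poly r (of_real t)}" for p r :: "complex poly"
  define S where "S = Z q1 0 \<union> Z a1 0 \<union> Z k1 0 \<union> (\<Union>n. Z (q1 ^ Suc n) 1) \<union>
    (\<Union>m n. Z (a1 * q1 ^ m) (q1 ^ n) \<union> Z (- a1 * q1 ^ m) (q1 ^ n) \<union> Z (k1 * q1 ^ m) (q1 ^ n) \<union>
      Z (- k1 * q1 ^ m) (q1 ^ n) \<union> Z (k1 * q1 ^ m) (a1 * q1 ^ n) \<union> Z (a1 * k1 * q1 ^ m) (q1 ^ n))"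
  have fin: "finite (Z p r)" if "poly p z \<noteq> poly r z" for p r z
    unfolding Z_def using that by (rule finite_real_agreement)
  \<comment> \<open>Each relation fails at a point where just one of its sides vanishes:
    \<open>- 1 / 2\<close> is the root of \<open>a1\<close> and \<open>- 1 / 3\<close> that of
    \<open>k1\<close>. The root \<open>- 1\<close> of \<open>q1\<close> handles the powers of
    \<open>q1\<close> compared with 1, and 0 handles the nonvanishing conditions.\<close>
  have q1: "poly q1 (- 1 / 2) \<noteq> 0" "poly q1 (- 1 / 3) \<noteq> 0" and a1: "poly a1 (- 1 / 2) = 0" "poly a1 (- 1 / 3) \<noteq> 0"
    and k1: "poly k1 (- 1 / 3) = 0" using nz by (simp_all add: q1_def a1_def k1_def)
  have "finite (Z q1 0)" "finite (Z a1 0)" "finite (Z k1 0)"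
    by (rule fin[of _ 0]; use nz in \<open>simp add: q1_def a1_def k1_def\<close>)+
  moreover have "finite (Z (q1 ^ Suc n) 1)" for n
    by (rule fin[of _ "- 1"]) (simp add: q1_def)
  moreover have "finite (Z (a1 * q1 ^ m) (q1 ^ n))" "finite (Z (- a1 * q1 ^ m) (q1 ^ n))"
      "finite (Z (a1 * k1 * q1 ^ m) (q1 ^ n))" for m n
    by (rule fin[of _ "- 1 / 2"]; use q1 a1 in simp)+
  moreover have "finite (Z (k1 * q1 ^ m) (q1 ^ n))" "finite (Z (- k1 * q1 ^ m) (q1 ^ n))"
      "finite (Z (k1 * q1 ^ m) (a1 * q1 ^ n))" for m n
    by (rule fin[of _ "- 1 / 3"]; use q1 a1 k1 in simp)+
  ultimately show "countable S"
    unfolding S_def by (intro countable_Un countable_UN) (auto intro: countable_finite)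
  fix t assume t: "t \<notin> S"
  have Z: "t \<in> Z p r \<longleftrightarrow> poly p (of_real t) = poly r (of_real t)" for p r
    by (simp add: Z_def)
  have "Q t \<noteq> 0" "A t \<noteq> 0" "K t \<noteq> 0" "Q t ^ Suc n \<noteq> 1" for n
    using t unfolding S_def by (auto simp: Z ev)
  moreover have "A t * Q t ^ m \<noteq> Q t ^ n" "- A t * Q t ^ m \<noteq> Q t ^ n" "K t * Q t ^ m \<noteq> Q t ^ n"
     "- K t * Q t ^ m \<noteq> Q t ^ n" "K t * Q t ^ m \<noteq> A t * Q t ^ n" "A t * K t * Q t ^ m \<noteq> Q t ^ n" for m n
    using t unfolding S_def by (auto simp: Z ev)
  moreover have "generic_base (Q t)"
    using calculation(1,4) by unfold_locales (auto simp: gr0_conv_Suc)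
  ultimately show "generic_base (Q t) \<and> A t \<noteq> 0 \<and> K t \<noteq> 0 \<and>
      generic (Q t) (A t) \<and> generic (Q t) (- A t) \<and> generic (Q t) (K t) \<and> generic (Q t) (- K t) \<and>
      generic (Q t) (K t / A t) \<and> generic (Q t) (A t * K t)"
    unfolding generic_def by (simp add: divide_eq_eq mult.commute)
qed

text \<open>The parameters are perturbed along a real line through the given point. The identity
  holds off a countable set of perturbations, and both sides are continuous at 0 because the
  denominators do not vanish there.\<close>

lemma finite_sum_identity:
  fixes q a k :: complex
  assumes nz: "q \<noteq> 0" "a \<noteq> 0" "k \<noteq> 0" "1 - k \<noteq> 0" "1 + a \<noteq> 0"
    and den_lhs: "\<And>n. n \<le> N \<Longrightarrow> qpochhammer q q n * qpochhammer (a * q) q (2 * n) *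
      qpochhammer (k * q ^ 2 / (a * q ^ (2 * N))) (q ^ 2) n *
      qpochhammer (k ^ 2 * q ^ 2 * q ^ (2 * N)) (q ^ 2) n \<noteq> 0"
    and den_rhs: "\<And>n. n \<le> N \<Longrightarrow> qpochhammer q q n * qpochhammer (a ^ 2 * q ^ 2 * q ^ (2 * N)) (q ^ 2) n *
      qpochhammer (a * q ^ 2 / (k * q ^ (2 * N))) (q ^ 2) n \<noteq> 0"
    and den: "qpochhammer (a / k) (q ^ 2) N * qpochhammer (a ^ 2 * q ^ 2) (q ^ 2) N *
      qpochhammer (- (k * q)) q (2 * N) \<noteq> 0"
  shows "lhs_sum N q a k = prefactor N q a k * rhs_sum N q a k"
proof -
  define Q A K where "Q t = q * (1 + of_real t)" and "A t = a * (1 + 2 * of_real t)"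
    and "K t = k * (1 + 3 * of_real t)" for t :: real
  obtain S where S: "countable S"
    and good: "\<And>t. t \<notin> S \<Longrightarrow> generic_base (Q t) \<and> A t \<noteq> 0 \<and> K t \<noteq> 0 \<and>
      generic (Q t) (A t) \<and> generic (Q t) (- A t) \<and> generic (Q t) (K t) \<and> generic (Q t) (- K t) \<and>
      generic (Q t) (K t / A t) \<and> generic (Q t) (A t * K t)"
    using generic_perturbation[OF nz(1-3)] unfolding Q_def A_def K_def by blast
  \<comment> \<open>Approaches 0 through generic parameters only; this filter is nontrivial because
    no interval is countable.\<close>
  define F where "F = at 0 within (- S)"
  have "0 islimpt (- S)"
    unfolding islimpt_approachable_le
  proof safe
    fix e :: real assume "e > 0"
    then obtain t where "t \<in> {0<..<e}" "t \<notin> S"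
      using open_minus_countable[OF S, of "{0<..<e}"] by auto
    then show "\<exists>x'\<in>- S. x' \<noteq> 0 \<and> dist x' 0 \<le> e" by (intro bexI[of _ t]) auto
  qed
  then have F: "F \<noteq> bot" by (simp add: F_def trivial_limit_within)
  have "(Q \<longlongrightarrow> q * (1 + of_real 0)) F" "(A \<longlongrightarrow> a * (1 + 2 * of_real 0)) F" "(K \<longlongrightarrow> k * (1 + 3 * of_real 0)) F"
    unfolding F_def Q_def A_def K_def by (intro tendsto_intros)+
  then have lim: "(Q \<longlongrightarrow> q) F" "(A \<longlongrightarrow> a) F" "(K \<longlongrightarrow> k) F" by simp_all
  have lhs: "((\<lambda>t. lhs_sum N (Q t) (A t) (K t)) \<longlongrightarrow> lhs_sum N q a k) F"
    by (rule tendsto_lhs_sum[OF lim nz(1-4) den_lhs])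
  have rhs: "((\<lambda>t. prefactor N (Q t) (A t) (K t) * rhs_sum N (Q t) (A t) (K t))
      \<longlongrightarrow> prefactor N q a k * rhs_sum N q a k) F"
    by (intro tendsto_mult tendsto_prefactor[OF lim nz(2,3) den] tendsto_rhs_sum[OF lim nz(1-3,5) den_rhs])
  have eq: "prefactor N (Q t) (A t) (K t) * rhs_sum N (Q t) (A t) (K t) = lhs_sum N (Q t) (A t) (K t)"
    if "t \<notin> S" for t
    using good[OF that] generic_base.generic_identity[of "Q t" "A t" "K t" N] by simp
  have "\<forall>\<^sub>F t in F. prefactor N (Q t) (A t) (K t) * rhs_sum N (Q t) (A t) (K t) = lhs_sum N (Q t) (A t) (K t)"
    unfolding F_def eventually_at_filter by (rule always_eventually) (simp add: eq)
  then show ?thesis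
    by (rule tendsto_unique[OF F lhs Lim_transform_eventually[OF rhs]])
qed

section \<open>Pairing the parameters of the original series\<close>

lemma qpochhammer_terminates:
  assumes "q \<noteq> 0" "N < n"
  shows "qpochhammer (1 / q ^ (2 * N)) (q ^ 2) n = 0"
  using assms by (auto simp: qpochhammer_eq_0_iff power_mult intro!: exI[of _ N])

theorem corollary14:
  fixes q a k :: complex
    and sqrt_a sqrt_k sqrt_q_div_a sqrt_ak sqrt_a_div_k :: complex
    and N :: nat
  assumes "N > 0" and "q \<noteq> 0" and "a \<noteq> 0" and "k \<noteq> 0"
    and "sqrt_a ^ 2 = a" and "sqrt_k ^ 2 = k" and "sqrt_q_div_a ^ 2 = q / a"
    and "sqrt_ak ^ 2 = a * k" and "sqrt_a_div_k ^ 2 = a / k"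
    and "nonzero_denominators
           (very_well_poised_lower sqrt_k k
             [q * a / k, k / sqrt_a, - k / sqrt_a, k * sqrt_q_div_a, - k * sqrt_q_div_a,
              sqrt_ak * q ^ N, - sqrt_ak * q ^ N, - (q powi (- int N)), q powi (- int N)] q) q N"
    and "qpochhammers [a / k, a ^ 2 * q ^ 2, - k * q, - k * q ^ 2] (q ^ 2) N \<noteq> 0"
    and "nonzero_denominators
           [\<i> * sqrt_a, - \<i> * sqrt_a, a * q ^ (1 + N), - a * q ^ (1 + N),
            sqrt_a_div_k * q powi (1 - int N), - sqrt_a_div_k * q powi (1 - int N)] q N"
  shows "very_well_poised sqrt_k k
           [q * a / k, k / sqrt_a, - k / sqrt_a, k * sqrt_q_div_a, - k * sqrt_q_div_a,
            sqrt_ak * q ^ N, - sqrt_ak * q ^ N, - (q powi (- int N)), q powi (- int N)] q (q ^ 2)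
       = qpochhammers [k / a, k ^ 2 * q ^ 2, - a, - a * q] (q ^ 2) N
           / qpochhammers [a / k, a ^ 2 * q ^ 2, - k * q, - k * q ^ 2] (q ^ 2) N
         * (a * q / k) ^ N
         * basic_hypergeom
             [\<i> * q * sqrt_a, - \<i> * q * sqrt_a, a ^ 2 * q / k ^ 2,
              sqrt_ak * q ^ N, - sqrt_ak * q ^ N, - (q powi (- int N)), q powi (- int N)]
             [\<i> * sqrt_a, - \<i> * sqrt_a, a * q ^ (1 + N), - a * q ^ (1 + N),
              sqrt_a_div_k * q powi (1 - int N), - sqrt_a_div_k * q powi (1 - int N)] q q"
proof -
  note nz = assms(2-4)
  note sq = assms(5-9)
  have root_nz: "sqrt_a \<noteq> 0" "sqrt_q_div_a \<noteq> 0" "sqrt_ak \<noteq> 0"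
    using sq nz by auto
  have sqrt_ak_q: "(sqrt_ak * q ^ N) ^ 2 = a * k * q ^ (2 * N)"
    using sq(4) by (simp add: power_mult_distrib power_mult mult.commute[of N] flip: power_mult)
  have powi: "q powi (- int N) = 1 / q ^ N" "q powi (1 - int N) = q / q ^ N"
    using nz by (simp_all add: power_int_minus power_int_diff divide_inverse)
  \<comment> \<open>The square \<open>z\<close> is left to the user of the rule, so the chosen
    square roots enter only through their defining equations.\<close>
  have pair: "qpochhammer x q n * qpochhammer y q n = qpochhammer z (q ^ 2) n"
    if "y = - x" "x ^ 2 = z" for x y z n
    unfolding that(1) that(2)[symmetric] qpochhammer_square ..
  define P where "P x n = qpochhammer x q n" for x n
  define P2 where "P2 x n = qpochhammer x (q ^ 2) n" for x n
  note PP = P_def[symmetric] P2_def[symmetric]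
  let ?cs = "[q * a / k, k / sqrt_a, - k / sqrt_a, k * sqrt_q_div_a, - k * sqrt_q_div_a,
            sqrt_ak * q ^ N, - sqrt_ak * q ^ N, - (q powi (- int N)), q powi (- int N)]"
  let ?as = "[\<i> * q * sqrt_a, - \<i> * q * sqrt_a, a ^ 2 * q / k ^ 2,
              sqrt_ak * q ^ N, - sqrt_ak * q ^ N, - (q powi (- int N)), q powi (- int N)]"
  let ?bs = "[\<i> * sqrt_a, - \<i> * sqrt_a, a * q ^ (1 + N), - a * q ^ (1 + N),
              sqrt_a_div_k * q powi (1 - int N), - sqrt_a_div_k * q powi (1 - int N)]"
  have low1: "qpochhammers (q # very_well_poised_lower sqrt_k k ?cs q) q n =
     P q n * P2 k n * P (k ^ 2 / a) n * P (a * q) (2 * n) * P2 (k * q ^ 2 / (a * q ^ (2 * N))) n *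
     P2 (k ^ 2 * q ^ 2 * q ^ (2 * N)) n" for n
  proof -
    have "qpochhammers (q # very_well_poised_lower sqrt_k k ?cs q) q n = P q n *
      (P sqrt_k n * P (- sqrt_k) n) * P (k * q / (q * a / k)) n *
      (P (k * q / (k / sqrt_a)) n * P (k * q / (- k / sqrt_a)) n) *
      (P (k * q / (k * sqrt_q_div_a)) n * P (k * q / (- k * sqrt_q_div_a)) n) *
      (P (k * q / (sqrt_ak * q ^ N)) n * P (k * q / (- sqrt_ak * q ^ N)) n) *
      (P (k * q / (q powi (- int N))) n * P (k * q / - (q powi (- int N))) n)"
      unfolding qpochhammers_def very_well_poised_lower_def P_def by (simp add: mult_ac)
    also have "P sqrt_k n * P (- sqrt_k) n = P2 k n"
      unfolding P_def P2_def using sq by (intro pair) auto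
    also have "P (k * q / (k / sqrt_a)) n * P (k * q / (- k / sqrt_a)) n = P2 (a * q ^ 2) n"
      unfolding P_def P2_def sq(1)[symmetric] using nz by (intro pair) (auto simp: power_mult_distrib)
    also have "P (k * q / (k * sqrt_q_div_a)) n * P (k * q / (- k * sqrt_q_div_a)) n = P2 (a * q) n"
      unfolding P_def P2_def
    proof (intro pair)
      have "(k * q / (k * sqrt_q_div_a)) ^ 2 = q ^ 2 / sqrt_q_div_a ^ 2"
        using nz by (simp add: power_divide)
      also have "\<dots> = a * q" unfolding sq(3) using nz by (simp add: power2_eq_square)
      finally show "(k * q / (k * sqrt_q_div_a)) ^ 2 = a * q" .
    qed simp
    also have "P (k * q / (sqrt_ak * q ^ N)) n * P (k * q / (- sqrt_ak * q ^ N)) n = P2 (k * q ^ 2 / (a * q ^ (2 * N))) n"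
      unfolding P_def P2_def
    proof (intro pair)
      show "(k * q / (sqrt_ak * q ^ N)) ^ 2 = k * q ^ 2 / (a * q ^ (2 * N))"
        unfolding power_divide sqrt_ak_q using nz by (simp add: power2_eq_square)
    qed simp
    also have "P (k * q / (q powi (- int N))) n * P (k * q / - (q powi (- int N))) n = P2 (k ^ 2 * q ^ 2 * q ^ (2 * N)) n"
      unfolding P_def P2_def powi using nz
      by (intro pair) (auto simp: power_mult_distrib mult.commute[of 2] power_mult)
    also have "k * q / (q * a / k) = k ^ 2 / a"
      using nz by (simp add: power2_eq_square)
    finally have "qpochhammers (q # very_well_poised_lower sqrt_k k ?cs q) q n = P q n * P2 k n * P (k ^ 2 / a) n *
      P2 (a * q ^ 2) n * P2 (a * q) n * P2 (k * q ^ 2 / (a * q ^ (2 * N))) n * P2 (k ^ 2 * q ^ 2 * q ^ (2 * N)) n" .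
    moreover have "P (a * q) (2 * n) = P2 (a * q) n * P2 (a * q ^ 2) n"
      unfolding P_def P2_def qpochhammer_double by (simp add: power2_eq_square mult.assoc)
    ultimately show ?thesis by (simp add: mult_ac)
  qed
  have up1: "qpochhammers (k # q * sqrt_k # - (q * sqrt_k) # ?cs) q n =
     P k n * P2 (k * q ^ 2) n * P (q * a / k) n * P (k ^ 2 / a) n * P (k ^ 2 * q ^ n / a) n *
     P2 (a * k * q ^ (2 * N)) n * P2 (1 / q ^ (2 * N)) n" for n
  proof -
    have "qpochhammers (k # q * sqrt_k # - (q * sqrt_k) # ?cs) q n = P k n *
      (P (q * sqrt_k) n * P (- (q * sqrt_k)) n) * P (q * a / k) n *
      (P (k / sqrt_a) n * P (- k / sqrt_a) n) *
      (P (k * sqrt_q_div_a) n * P (- k * sqrt_q_div_a) n) *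
      (P (sqrt_ak * q ^ N) n * P (- sqrt_ak * q ^ N) n) *
      (P (q powi (- int N)) n * P (- (q powi (- int N))) n)"
      unfolding qpochhammers_def P_def by (simp add: mult_ac)
    also have "P (q * sqrt_k) n * P (- (q * sqrt_k)) n = P2 (k * q ^ 2) n"
      unfolding P_def P2_def by (intro pair) (auto simp: power_mult_distrib sq)
    also have "P (k / sqrt_a) n * P (- k / sqrt_a) n = P2 (k ^ 2 / a) n"
      unfolding P_def P2_def by (intro pair) (auto simp: power_divide sq)
    also have "P (k * sqrt_q_div_a) n * P (- k * sqrt_q_div_a) n = P2 (k ^ 2 / a * q) n"
      unfolding P_def P2_def by (intro pair) (auto simp: power_mult_distrib sq)
    also have "P (sqrt_ak * q ^ N) n * P (- sqrt_ak * q ^ N) n = P2 (a * k * q ^ (2 * N)) n"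
      unfolding P_def P2_def by (intro pair) (auto simp: sqrt_ak_q)
    also have "P (q powi (- int N)) n * P (- (q powi (- int N))) n = P2 (1 / q ^ (2 * N)) n"
      unfolding P_def P2_def powi
      by (intro pair) (auto simp: power_one_over mult.commute[of 2] power_mult)
    finally have "qpochhammers (k # q * sqrt_k # - (q * sqrt_k) # ?cs) q n = P k n * P2 (k * q ^ 2) n *
       P (q * a / k) n * (P2 (k ^ 2 / a) n * P2 (k ^ 2 / a * q) n) * P2 (a * k * q ^ (2 * N)) n * P2 (1 / q ^ (2 * N)) n"
      by (simp add: mult_ac)
    also have "P2 (k ^ 2 / a) n * P2 (k ^ 2 / a * q) n = P (k ^ 2 / a) (2 * n)"
      unfolding P_def P2_def qpochhammer_double ..
    \<comment> \<open>The half \<open>P (k ^ 2 / a) n\<close> is the one that cancels against the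
      same factor in \<open>low1\<close>.\<close>
    also have "\<dots> = P (k ^ 2 / a) n * P (k ^ 2 * q ^ n / a) n"
      unfolding mult_2 P_def qpochhammer_add by simp
    finally show ?thesis by (simp add: mult_ac)
  qed
  have low2: "qpochhammers (q # ?bs) q n = P q n * P2 (- a) n * P2 (a ^ 2 * q ^ 2 * q ^ (2 * N)) n *
     P2 (a * q ^ 2 / (k * q ^ (2 * N))) n" for n
  proof -
    have "qpochhammers (q # ?bs) q n = P q n *
      (P (\<i> * sqrt_a) n * P (- \<i> * sqrt_a) n) *
      (P (a * q ^ (1 + N)) n * P (- a * q ^ (1 + N)) n) *
      (P (sqrt_a_div_k * q powi (1 - int N)) n * P (- sqrt_a_div_k * q powi (1 - int N)) n)"
      unfolding qpochhammers_def P_def by (simp add: mult_ac)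
    also have "P (\<i> * sqrt_a) n * P (- \<i> * sqrt_a) n = P2 (- a) n"
      unfolding P_def P2_def by (intro pair) (auto simp: power_mult_distrib sq)
    also have "P (a * q ^ (1 + N)) n * P (- a * q ^ (1 + N)) n = P2 (a ^ 2 * q ^ 2 * q ^ (2 * N)) n"
      unfolding P_def P2_def
      by (intro pair) (auto simp: power_mult_distrib mult.commute[of 2] power_mult)
    also have "P (sqrt_a_div_k * q powi (1 - int N)) n * P (- sqrt_a_div_k * q powi (1 - int N)) n =
        P2 (a * q ^ 2 / (k * q ^ (2 * N))) n"
      unfolding P_def P2_def powi
      by (intro pair) (auto simp: power_mult_distrib power_divide sq mult.commute[of 2] power_mult)
    finally show ?thesis by (simp add: mult_ac)
  qed
  have up2: "qpochhammers ?as q n = P2 (- a * q ^ 2) n * P (a ^ 2 * q / k ^ 2) n *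
     P2 (a * k * q ^ (2 * N)) n * P2 (1 / q ^ (2 * N)) n" for n
  proof -
    have "qpochhammers ?as q n =
      (P (\<i> * q * sqrt_a) n * P (- \<i> * q * sqrt_a) n) * P (a ^ 2 * q / k ^ 2) n *
      (P (sqrt_ak * q ^ N) n * P (- sqrt_ak * q ^ N) n) *
      (P (q powi (- int N)) n * P (- (q powi (- int N))) n)"
      unfolding qpochhammers_def P_def by (simp add: mult_ac)
    also have "P (\<i> * q * sqrt_a) n * P (- \<i> * q * sqrt_a) n = P2 (- a * q ^ 2) n"
      unfolding P_def P2_def by (intro pair) (auto simp: power_mult_distrib sq)
    also have "P (sqrt_ak * q ^ N) n * P (- sqrt_ak * q ^ N) n = P2 (a * k * q ^ (2 * N)) n"
      unfolding P_def P2_def by (intro pair) (auto simp: sqrt_ak_q)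
    also have "P (q powi (- int N)) n * P (- (q powi (- int N))) n = P2 (1 / q ^ (2 * N)) n"
      unfolding P_def P2_def powi
      by (intro pair) (auto simp: power_one_over mult.commute[of 2] power_mult)
    finally show ?thesis by (simp add: mult_ac)
  qed
  have pre_low: "qpochhammers [a / k, a ^ 2 * q ^ 2, - k * q, - k * q ^ 2] (q ^ 2) N =
      P2 (a / k) N * P2 (a ^ 2 * q ^ 2) N * P (- (k * q)) (2 * N)"
    unfolding P_def P2_def qpochhammer_double qpochhammers_def by (simp add: mult_ac power2_eq_square)
  have pre_up: "qpochhammers [k / a, k ^ 2 * q ^ 2, - a, - a * q] (q ^ 2) N =
      P2 (k / a) N * P2 (k ^ 2 * q ^ 2) N * P (- a) (2 * N)"
    unfolding P_def P2_def qpochhammer_double qpochhammers_def by (simp add: mult_ac)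
  have d1: "P q n * P2 k n * P (k ^ 2 / a) n * P (a * q) (2 * n) * P2 (k * q ^ 2 / (a * q ^ (2 * N))) n *
     P2 (k ^ 2 * q ^ 2 * q ^ (2 * N)) n \<noteq> 0" if "n \<le> N" for n
    using assms(10) that unfolding nonzero_denominators_def low1[symmetric] by blast
  have d2: "P q n * P2 (- a) n * P2 (a ^ 2 * q ^ 2 * q ^ (2 * N)) n *
     P2 (a * q ^ 2 / (k * q ^ (2 * N))) n \<noteq> 0" if "n \<le> N" for n
    using assms(12) that unfolding nonzero_denominators_def low2[symmetric] by blast
  have d0: "P2 (a / k) N * P2 (a ^ 2 * q ^ 2) N * P (- (k * q)) (2 * N) \<noteq> 0"
    using assms(11) unfolding pre_low .
  \<comment> \<open>Positivity of \<open>N\<close> admits the index 1, where the denominators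
    contain \<open>1 - k\<close> and \<open>1 + a\<close>.\<close>
  have k1: "1 - k \<noteq> 0" and a1: "1 + a \<noteq> 0"
    using d1[of 1] d2[of 1] assms(1) by (auto simp: P2_def)
  \<comment> \<open>Used with \<open>x = k\<close> on the left and \<open>x = - a\<close> on the
    right.\<close>
  have vwp: "P2 (x * q ^ 2) n = (1 - x * q ^ (2 * n)) / (1 - x) * P2 x n" if "1 - x \<noteq> 0" for x n
    unfolding P2_def power_mult using qpochhammer_shift[of x "q ^ 2" n] that
    by (simp add: eq_divide_eq mult.commute)
  have terminates: "P2 (1 / q ^ (2 * N)) n = 0" if "n \<notin> {..N}" for n
    using qpochhammer_terminates[OF nz(1)] that by (simp add: P2_def not_le)
  have "very_well_poised sqrt_k k ?cs q (q ^ 2) = lhs_sum N q a k"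
  proof -
    have "very_well_poised sqrt_k k ?cs q (q ^ 2) = (\<Sum>n. qpochhammers (k # q * sqrt_k # - (q * sqrt_k) # ?cs) q n /
        qpochhammers (q # very_well_poised_lower sqrt_k k ?cs q) q n * (q ^ 2) ^ n)"
      unfolding very_well_poised_def basic_hypergeom_def ..
    also have "\<dots> = (\<Sum>n\<le>N. qpochhammers (k # q * sqrt_k # - (q * sqrt_k) # ?cs) q n /
        qpochhammers (q # very_well_poised_lower sqrt_k k ?cs q) q n * (q ^ 2) ^ n)"
      by (rule suminf_finite[OF finite_atMost]) (simp only: up1, simp add: terminates)
    also have "\<dots> = lhs_sum N q a k"
      unfolding lhs_sum_def PP
    proof (intro sum.cong refl)
      fix n assume "n \<in> {..N}"
      then have "P2 k n \<noteq> 0" "P (k ^ 2 / a) n \<noteq> 0" using d1[of n] by auto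
      then show "qpochhammers (k # q * sqrt_k # - (q * sqrt_k) # ?cs) q n /
        qpochhammers (q # very_well_poised_lower sqrt_k k ?cs q) q n * (q ^ 2) ^ n =
       (1 - k * q ^ (2 * n)) / (1 - k) *
       (P k n * P (q * a / k) n * P (k ^ 2 * q ^ n / a) n * P2 (a * k * q ^ (2 * N)) n * P2 (1 / q ^ (2 * N)) n) /
       (P q n * P (a * q) (2 * n) * P2 (k * q ^ 2 / (a * q ^ (2 * N))) n * P2 (k ^ 2 * q ^ 2 * q ^ (2 * N)) n) * (q ^ 2) ^ n"
        unfolding up1 low1 vwp[OF k1] by (simp add: mult_ac)
    qed
    finally show ?thesis .
  qed
  moreover have "basic_hypergeom ?as ?bs q q = rhs_sum N q a k"
  proof -
    have "basic_hypergeom ?as ?bs q q = (\<Sum>n\<le>N. qpochhammers ?as q n / qpochhammers (q # ?bs) q n * q ^ n)"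
      unfolding basic_hypergeom_def
      by (rule suminf_finite[OF finite_atMost]) (simp only: up2, simp add: terminates)
    also have "\<dots> = rhs_sum N q a k"
      unfolding rhs_sum_def PP
    proof (intro sum.cong refl)
      fix n assume "n \<in> {..N}"
      then have "P2 (- a) n \<noteq> 0" using d2[of n] by auto
      moreover have "1 - (- a) \<noteq> 0" using a1 by simp
      ultimately show "qpochhammers ?as q n / qpochhammers (q # ?bs) q n * q ^ n =
       (1 + a * q ^ (2 * n)) / (1 + a) *
       (P (a ^ 2 * q / k ^ 2) n * P2 (a * k * q ^ (2 * N)) n * P2 (1 / q ^ (2 * N)) n) /
       (P q n * P2 (a ^ 2 * q ^ 2 * q ^ (2 * N)) n * P2 (a * q ^ 2 / (k * q ^ (2 * N))) n) * q ^ n"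
        unfolding up2 low2 vwp[of "- a", OF \<open>1 - (- a) \<noteq> 0\<close>] by (simp add: mult_ac)
    qed
    finally show ?thesis .
  qed
  moreover have "lhs_sum N q a k = prefactor N q a k * rhs_sum N q a k"
    using d0 d1 d2 by (intro finite_sum_identity nz k1 a1) (auto simp: PP)
  ultimately show ?thesis
    unfolding pre_low pre_up prefactor_def PP by simp
qed

end
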